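(* Consider, in the phase space $C_g^0(\mathbb R^n)$, the system $$x_i'(t)=-\sum_{j=1}^n\sum_{k=1}^p d_{ij}^k(t)\int_{-\tau_{ij}^k(t)}^0 x_j(t+s)\,d_s\xi_{ij}^k(t,s),\qquad t\ge0,\ i=1,\dots,n,\qquad( * )$$ and assume: (h1) $d_{ij}^k:[0,\infty)\to\mathbb R$ and $\tau_{ij}^k:[0,\infty)\to[0,\infty)$ are continuous, and $\xi_{ij}^k(t,s)$ are continuous in $t\in[0,\infty)$ and of bounded variation in $s\in[-\tau_{ij}^k(t),0]$, with $\mathrm{Var}_{s\in[-\tau_{ij}^k(t),0]}\,\xi_{ij}^k(t,s)=1$, for $i,j=1,\dots,n$, $k=1,\dots,p$; (h2) $s\mapsto\xi_{ii}^k(t,s)$ is nondecreasing for $t\ge0$, $1\le i\le n$, $1\le k\le p$; (h3') all functions $d_{ii}^k$ are nonnegative on $[0,\infty)$, with $d_i(t):=\sum_{k=1}^p d_{ii}^k(t)>0$; (h4') there is $r>0$ with $\tau_{ii}^k(t)\in[0,r]$ for $t\ge0$, $1\le i\le n$, $1\le k\le p$. Let $M(t)=D(t)-\widehat C^\tau(t)-\widehat A^\tau(t)$, where $D(t)=\mathrm{diag}(d_1(t),\dots,d_n(t))$, $\widehat A^\tau(t)=[\widehat a_{ij}^\tau(t)]$, $\widehat C^\tau(t)=\mathrm{diag}(\widehat c_1^\tau(t),\dots,\widehat c_n^\tau(t))$, with, for $1\le i,j\le n$, $$\widehat a_{ij}^\tau(t)=\sum_{k=1}^p g(-\tau_{ij}^k(t))\,|d_{ij}^k(t)|\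 \ (i\ne j),\qquad \widehat a_{ii}^\tau(t)=0,$$ $$\widehat c_i^\tau(t)=\sum_{k=1}^p d_{ii}^k(t)\int_{t-\tau_{ii}^k(t)}^t\sum_{l=1}^p\sum_{j=1}^n g(-\tau_{ij}^l(u))\,|d_{ij}^l(u)|\,du.$$ Assume that there exist $\alpha>1$, $T\ge0$, a vector $v>0$ in $\mathbb R^n$ and a measurable, locally integrable function $e:\mathbb R\to[0,\infty)$ such that: (i) $\min_{1\le i\le n}(M(t)v)_i\ge e(t)$ for $t\ge T$; (ii) $D(t)v\ge\alpha\big(\widehat C^\tau(t)+\widehat A^\tau(t)\big)v$ for $t\ge T$; (iii) $\int_0^\infty e(t)\,dt=\infty$; (iv) $\sup_{t\ge T}\int_{t-\tau(t)}^t e(u)\,du<\infty$, for $\tau(t)=\max\{\tau_{ij}^k(t):1\le i,j\le n,\ 1\le k\le p\}$. Then $( * )$ is asymptotically stable.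
   Context: Phase space: $g:(-\infty,0]\to[1,\infty)$ is a fixed nonincreasing continuous function with $g(0)=1$, $\lim_{s\to-\infty}g(s)=\infty$ and $\lim_{u\to0^-}g(s+u)/g(s)=1$ uniformly for $s\in(-\infty,0]$. $\mathcal C=C_g^0(\mathbb R^n)$ is the Banach space of continuous $\phi:(-\infty,0]\to\mathbb R^n$ with $\lim_{s\to-\infty}|\phi(s)|/g(s)=0$, with norm $\|\phi\|=\sup_{s\le0}|\phi(s)|/g(s)$, where $|x|=\max_i|x_i|$. $x_t(s)=x(t+s)$ for $s\le0$. As a standing assumption, the right-hand side of $( * )$, viewed as a function of $(t,x_t)\in[0,\infty)\times\mathcal C$, is continuous. Vector inequalities are componentwise; $v>0$ means all components are positive. The quantities $\widehat c_i^\tau(t)$ are considered for $t\ge r$ (one takes $T\ge r$). For $\sigma\ge0$, $\phi\in\mathcal C$, $x(t,\sigma,\phi)$, $t\ge\sigma$, is the solution with $x_\sigma=\phi$, and $x_t(\sigma,\phi)$ its history in $\mathcal C$. The system is stable on $[\alpha,\infty)$ if for every $\varepsilon>0$ and $\sigma\ge\alpha$ there is $\delta=\delta(\varepsilon,\sigma)>0$ such that $\|\phi\|<\delta$ implies $\|x_t(\sigma,\phi)\|<\varepsilon$ for all $t\ge\sigma$. It is asymptotically stable if it is stable on some interval $[\alpha,\infty)\subset[0,\infty)$ and $\lim_{t\to\infty}x(t,\sigma,\phi)=0$ for all $\sigma\ge0$, $\phi\in\mathcal C$. *)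

theory Defs
  imports "HOL-Analysis.Analysis"
begin

text \<open>
  A division of \<open>{a..b}\<close> consists of compact intervals, so \<open>Inf K\<close> and \<open>Sup K\<close> are the endpoints of a
  cell. For \<open>a = b\<close> the variation and the Riemann--Stieltjes integral are both zero.
\<close>

definition variation_sums :: "real \<Rightarrow> real \<Rightarrow> (real \<Rightarrow> real) \<Rightarrow> real set" where
  "variation_sums a b \<xi> = {\<Sum>K\<in>P. \<bar>\<xi> (Sup K) - \<xi> (Inf K)\<bar> | P. P division_of {a..b}}"

definition bounded_variation_on :: "real \<Rightarrow> real \<Rightarrow> (real \<Rightarrow> real) \<Rightarrow> bool" where
  "bounded_variation_on a b \<xi> \<longleftrightarrow> bdd_above (variation_sums a b \<xi>)"

definition total_variation :: "real \<Rightarrow> real \<Rightarrow> (real \<Rightarrow> real) \<Rightarrow> real" where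
  "total_variation a b \<xi> = Sup (variation_sums a b \<xi>)"

text \<open>
  Mesh convergence of the sums: the tolerance \<open>\<delta>\<close> is a constant, not a gauge.
\<close>

definition has_RS_integral :: "(real \<Rightarrow> real) \<Rightarrow> (real \<Rightarrow> real) \<Rightarrow> real \<Rightarrow> real \<Rightarrow> real \<Rightarrow> bool" where
  "has_RS_integral f \<xi> a b I \<longleftrightarrow>
     (\<forall>\<epsilon>>0. \<exists>\<delta>>0. \<forall>P. P tagged_division_of {a..b} \<and> (\<forall>(x, K)\<in>P. diameter K < \<delta>) \<longrightarrow>
        \<bar>(\<Sum>(x, K)\<in>P. f x * (\<xi> (Sup K) - \<xi> (Inf K))) - I\<bar> < \<epsilon>)"

definition RS_integral :: "real \<Rightarrow> real \<Rightarrow> (real \<Rightarrow> real) \<Rightarrow> (real \<Rightarrow> real) \<Rightarrow> real" where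
  "RS_integral a b f \<xi> = (THE I. has_RS_integral f \<xi> a b I)"

definition phase_weight :: "(real \<Rightarrow> real) \<Rightarrow> bool" where
  "phase_weight g \<longleftrightarrow>
     (\<forall>s\<le>0. 1 \<le> g s) \<and> antimono_on {..0} g \<and> continuous_on {..0} g \<and> g 0 = 1 \<and>
     filterlim g at_top at_bot \<and>
     uniform_limit {..0} (\<lambda>u s. g (s + u) / g s) (\<lambda>s. 1) (at_left 0)"

text \<open>
  Elements of the phase space are represented by total functions of which only the values on
  \<open>{..0}\<close> matter. The library's \<open>infnorm\<close> is the maximum norm on \<open>real ^ 'n\<close>.
\<close>

definition phase_space :: "(real \<Rightarrow> real) \<Rightarrow> (real \<Rightarrow> real ^ 'n) set" where
  "phase_space g = {\<phi>. continuous_on {..0} \<phi> \<and> ((\<lambda>s. infnorm (\<phi> s) / g s) \<longlongrightarrow> 0) at_bot}"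

definition phase_norm :: "(real \<Rightarrow> real) \<Rightarrow> (real \<Rightarrow> real ^ 'n) \<Rightarrow> real" where
  "phase_norm g \<phi> = (SUP s\<in>{..0}. infnorm (\<phi> s) / g s)"

definition history :: "(real \<Rightarrow> real ^ 'n) \<Rightarrow> real \<Rightarrow> real \<Rightarrow> real ^ 'n" where
  "history x t = (\<lambda>s. x (t + s))"

definition continuous_on_phase ::
  "(real \<Rightarrow> real) \<Rightarrow> (real \<Rightarrow> (real \<Rightarrow> real ^ 'n) \<Rightarrow> real ^ 'n) \<Rightarrow> bool" where
  "continuous_on_phase g F \<longleftrightarrow>
     (\<forall>t\<ge>0. \<forall>\<phi>\<in>phase_space g. \<forall>\<epsilon>>0. \<exists>\<delta>>0. \<forall>u\<ge>0. \<forall>\<psi>\<in>phase_space g.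
        \<bar>u - t\<bar> < \<delta> \<and> phase_norm g (\<lambda>s. \<psi> s - \<phi> s) < \<delta> \<longrightarrow> infnorm (F u \<psi> - F t \<phi>) < \<epsilon>)"

definition fde_solution ::
  "(real \<Rightarrow> (real \<Rightarrow> real ^ 'n) \<Rightarrow> real ^ 'n) \<Rightarrow> real \<Rightarrow> (real \<Rightarrow> real ^ 'n) \<Rightarrow> (real \<Rightarrow> real ^ 'n) \<Rightarrow> bool"
where
  "fde_solution F \<sigma> \<phi> x \<longleftrightarrow>
     (\<forall>s\<le>0. history x \<sigma> s = \<phi> s) \<and>
     (\<forall>t\<ge>\<sigma>. (x has_vector_derivative F t (history x t)) (at t within {\<sigma>..}))"

text \<open>
  The solution \<open>x(t, \<sigma>, \<phi>)\<close> is rendered by quantifying over all \<open>x\<close> with \<open>fde_solution F \<sigma> \<phi> x\<close>; for a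
  linear right-hand side that is continuous on the phase space it exists globally and is unique on
  the whole line.
\<close>

definition stable_from ::
  "(real \<Rightarrow> real) \<Rightarrow> (real \<Rightarrow> (real \<Rightarrow> real ^ 'n) \<Rightarrow> real ^ 'n) \<Rightarrow> real \<Rightarrow> bool" where
  "stable_from g F \<alpha> \<longleftrightarrow>
     (\<forall>\<epsilon>>0. \<forall>\<sigma>\<ge>\<alpha>. \<exists>\<delta>>0. \<forall>\<phi>\<in>phase_space g. \<forall>x.
        phase_norm g \<phi> < \<delta> \<and> fde_solution F \<sigma> \<phi> x \<longrightarrow>
        (\<forall>t\<ge>\<sigma>. phase_norm g (history x t) < \<epsilon>))"

definition asymptotically_stable ::
  "(real \<Rightarrow> real) \<Rightarrow> (real \<Rightarrow> (real \<Rightarrow> real ^ 'n) \<Rightarrow> real ^ 'n) \<Rightarrow> bool" where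
  "asymptotically_stable g F \<longleftrightarrow>
     (\<exists>\<alpha>\<ge>0. stable_from g F \<alpha>) \<and>
     (\<forall>\<sigma>\<ge>0. \<forall>\<phi>\<in>phase_space g. \<forall>x. fde_solution F \<sigma> \<phi> x \<longrightarrow> (x \<longlongrightarrow> 0) at_top)"

definition system_rhs ::
  "nat \<Rightarrow> ('n \<Rightarrow> 'n \<Rightarrow> nat \<Rightarrow> real \<Rightarrow> real) \<Rightarrow> ('n \<Rightarrow> 'n \<Rightarrow> nat \<Rightarrow> real \<Rightarrow> real) \<Rightarrow>
   ('n \<Rightarrow> 'n \<Rightarrow> nat \<Rightarrow> real \<Rightarrow> real \<Rightarrow> real) \<Rightarrow> real \<Rightarrow> (real \<Rightarrow> real ^ 'n) \<Rightarrow> real ^ 'n" where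
  "system_rhs p d \<tau> \<xi> t \<phi> =
     (\<chi> i. - (\<Sum>j\<in>UNIV. \<Sum>k=1..p.
        d i j k t * RS_integral (- \<tau> i j k t) 0 (\<lambda>s. \<phi> s $ j) (\<xi> i j k t)))"

definition d_diag :: "nat \<Rightarrow> ('n \<Rightarrow> 'n \<Rightarrow> nat \<Rightarrow> real \<Rightarrow> real) \<Rightarrow> 'n \<Rightarrow> real \<Rightarrow> real" where
  "d_diag p d i t = (\<Sum>k=1..p. d i i k t)"

definition a_hat ::
  "(real \<Rightarrow> real) \<Rightarrow> nat \<Rightarrow> ('n \<Rightarrow> 'n \<Rightarrow> nat \<Rightarrow> real \<Rightarrow> real) \<Rightarrow>
   ('n \<Rightarrow> 'n \<Rightarrow> nat \<Rightarrow> real \<Rightarrow> real) \<Rightarrow> 'n \<Rightarrow> 'n \<Rightarrow> real \<Rightarrow> real" where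
  "a_hat g p d \<tau> i j t = (if i = j then 0 else \<Sum>k=1..p. g (- \<tau> i j k t) * \<bar>d i j k t\<bar>)"

definition c_hat ::
  "(real \<Rightarrow> real) \<Rightarrow> nat \<Rightarrow> ('n::finite \<Rightarrow> 'n \<Rightarrow> nat \<Rightarrow> real \<Rightarrow> real) \<Rightarrow>
   ('n \<Rightarrow> 'n \<Rightarrow> nat \<Rightarrow> real \<Rightarrow> real) \<Rightarrow> 'n \<Rightarrow> real \<Rightarrow> real" where
  "c_hat g p d \<tau> i t =
     (\<Sum>k=1..p. d i i k t *
        (LINT u:{t - \<tau> i i k t..t}|lebesgue.
           (\<Sum>l=1..p. \<Sum>j\<in>UNIV. g (- \<tau> i j l u) * \<bar>d i j l u\<bar>)))"

definition diag_mat :: "('n \<Rightarrow> real) \<Rightarrow> real ^ 'n ^ 'n" where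
  "diag_mat f = (\<chi> i j. if i = j then f i else 0)"

definition D_mat :: "nat \<Rightarrow> ('n \<Rightarrow> 'n \<Rightarrow> nat \<Rightarrow> real \<Rightarrow> real) \<Rightarrow> real \<Rightarrow> real ^ 'n ^ 'n" where
  "D_mat p d t = diag_mat (\<lambda>i. d_diag p d i t)"

definition C_mat ::
  "(real \<Rightarrow> real) \<Rightarrow> nat \<Rightarrow> ('n::finite \<Rightarrow> 'n \<Rightarrow> nat \<Rightarrow> real \<Rightarrow> real) \<Rightarrow>
   ('n \<Rightarrow> 'n \<Rightarrow> nat \<Rightarrow> real \<Rightarrow> real) \<Rightarrow> real \<Rightarrow> real ^ 'n ^ 'n" where
  "C_mat g p d \<tau> t = diag_mat (\<lambda>i. c_hat g p d \<tau> i t)"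

definition A_mat ::
  "(real \<Rightarrow> real) \<Rightarrow> nat \<Rightarrow> ('n \<Rightarrow> 'n \<Rightarrow> nat \<Rightarrow> real \<Rightarrow> real) \<Rightarrow>
   ('n \<Rightarrow> 'n \<Rightarrow> nat \<Rightarrow> real \<Rightarrow> real) \<Rightarrow> real \<Rightarrow> real ^ 'n ^ 'n" where
  "A_mat g p d \<tau> t = (\<chi> i j. a_hat g p d \<tau> i j t)"

definition M_mat ::
  "(real \<Rightarrow> real) \<Rightarrow> nat \<Rightarrow> ('n::finite \<Rightarrow> 'n \<Rightarrow> nat \<Rightarrow> real \<Rightarrow> real) \<Rightarrow>
   ('n \<Rightarrow> 'n \<Rightarrow> nat \<Rightarrow> real \<Rightarrow> real) \<Rightarrow> real \<Rightarrow> real ^ 'n ^ 'n" where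
  "M_mat g p d \<tau> t = D_mat p d t - C_mat g p d \<tau> t - A_mat g p d \<tau> t"

definition max_delay :: "nat \<Rightarrow> ('n \<Rightarrow> 'n \<Rightarrow> nat \<Rightarrow> real \<Rightarrow> real) \<Rightarrow> real \<Rightarrow> real" where
  "max_delay p \<tau> t = Max {\<tau> i j k t | i j k. k \<in> {1..p}}"

end

theory Submission
  imports Defs
begin

text \<open>
  Write \<open>\<beta> = 1 / \<alpha>\<close>, let \<open>\<theta>\<^sub>i(t)\<close> be the relative strength
  \<open>(\<Sum>\<^sub>j a\<^sub>i\<^sub>j(t) v\<^sub>j) / (v\<^sub>i d\<^sub>i(t))\<close> of the coupling into the \<open>i\<close>-th component, and measure time by the
  intrinsic clock \<open>H\<^sub>i\<close> with \<open>H\<^sub>i' = d\<^sub>i\<close>. Since the diagonal integrators are monotone with variation one,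
  the \<open>i\<close>-th equation says that, on this clock, \<open>x\<^sub>i\<close> has the derivative minus an average of its own
  recent values plus the coupling (lemma \<open>component_drift\<close>). The dominance hypothesis (ii) bounds the
  mean delay in that average, on the intrinsic clock, by \<open>\<beta> - \<theta>\<^sub>i\<close>.

  Normalise by \<open>z = x\<^sub>i / (v\<^sub>i B)\<close>, where \<open>B\<close> bounds all \<open>\<bar>x\<^sub>j\<bar> / v\<^sub>j\<close> on the history (relative to \<open>g\<close> on
  the initial part). The obvious argument replaces the delayed values by the present one and charges
  the difference to the Lipschitz constant of \<open>z\<close>. On the intrinsic clock that constant is only known
  to be at most \<open>1 + \<theta>\<^sub>i < 2\<close>, while the row sum inside \<open>c\<^sub>i\<close> carries no ratio \<open>v\<^sub>j / v\<^sub>i\<close> and therefore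
  in general provides only for the constant \<open>1\<close>. The lemma \<open>averaged_delay_decay\<close> closes this gap by
  an argument in the spirit of the \<open>3/2\<close>-theorem for scalar
  delay equations: \<open>z\<close> cannot climb steeply from \<open>-1\<close> for long, because after a part of the climb its
  recent values have already risen. The outcome is \<open>z' \<le> d\<^sub>i (\<beta> - z)\<close> whenever \<open>z > \<beta>\<close>.

  This inequality yields both conclusions. At the first time at which some \<open>\<bar>x\<^sub>j\<bar>\<close> reached \<open>v\<^sub>j B\<close> it would force
  a decrease, so bounds persist (\<open>solution_stays_bounded\<close>); a bound of Gronwall type on a compact interval
  supplies the initial \<open>B\<close> (\<open>solution_growth\<close>), and stability follows. It also pulls every
  component below \<open>(1 + \<beta>) / 2 \<cdot> v\<^sub>j B\<close> once the delayed arguments lie where the bound \<open>B\<close> holds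
  (\<open>eventual_bound_improves\<close>), and iterating gives convergence to zero. Hypothesis (i) yields \<open>e \<le> d\<^sub>i v\<^sub>i\<close>, so
  by (iii) the clocks \<open>H\<^sub>i\<close> run to infinity, and (iii) and (iv) together imply \<open>t - \<tau>\<^sub>i\<^sub>j\<^sup>k(t) \<rightarrow> \<infinity>\<close>.

  The integrals in the system are limits of Riemann--Stieltjes sums as the mesh tends to zero. They
  exist for continuous integrands because two such sums can be compared on the common refinement of
  their divisions (\<open>RS_sums_close\<close>); the estimates used above then pass from the sums to the limit.
\<close>

section \<open>Riemann--Stieltjes integrals\<close>

lemma tagged_cellE:
  fixes a b :: real
  assumes "P tagged_division_of {a..b}" "(x, K) \<in> P"
  obtains c d where "K = {c..d}" "a \<le> c" "c \<le> x" "x \<le> d" "d \<le> b"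
proof -
  obtain c d where K: "K = {c..d}"
    using tagged_division_ofD(4)[OF assms] by auto
  moreover have "x \<in> K" "K \<subseteq> {a..b}"
    using tagged_division_ofD(2,3)[OF assms] by auto
  ultimately show ?thesis
    using that[of c d] by auto
qed

lemma sum_over_tagged_cells:
  fixes a b :: real
  assumes P: "P tagged_division_of {a..b}" and point: "\<And>u. h {u} = (0 :: real)"
  shows "(\<Sum>(x, K)\<in>P. h K) = (\<Sum>K\<in>snd ` P. h K)"
proof -
  let ?h = "\<lambda>K. if K = {} then 0 else h K"
  have "(\<Sum>(x, K)\<in>P. h K) = (\<Sum>(x, K)\<in>P. ?h K)"
    using tagged_division_ofD(2)[OF P] by (intro sum.cong) fastforce+
  also have "\<dots> = (\<Sum>K\<in>snd ` P. ?h K)"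
    by (rule sum.over_tagged_division_lemma[OF P]) (auto simp: point order.order_iff_strict)
  also have "\<dots> = (\<Sum>K\<in>snd ` P. h K)"
    using tagged_division_ofD(2)[OF P] by (intro sum.cong) fastforce+
  finally show ?thesis .
qed

text \<open>
  Over a division of \<open>{a..b}\<close>, the increments of \<open>\<xi>\<close> on the intersections with \<open>{c..d}\<close> add up to
  the increment on \<open>{c..d}\<close>. Composing \<open>\<xi>\<close> with the retraction onto \<open>{c..d}\<close> turns this into an
  ordinary telescoping sum; a cell disjoint from \<open>{c..d}\<close> contributes zero.
\<close>

lemma increment_sum_clamped:
  fixes \<xi> :: "real \<Rightarrow> real"
  assumes "Q tagged_division_of {a..b}" "a \<le> c" "c \<le> d" "d \<le> b"
  shows "\<xi> d - \<xi> c = (\<Sum>(y, L)\<in>Q. \<xi> (max c (min d (Sup L))) - \<xi> (max c (min d (Inf L))))"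
  using additive_tagged_division_1[of a b Q "\<lambda>x. \<xi> (max c (min d x))"] assms by simp

lemma increment_clamped_symmetric:
  fixes \<xi> :: "real \<Rightarrow> real"
  assumes "c \<le> d" "p \<le> q"
  shows "\<xi> (max c (min d q)) - \<xi> (max c (min d p)) = \<xi> (max p (min q d)) - \<xi> (max p (min q c))"
  using assms by (auto simp: max_def min_def)

lemma increment_clamped_Int:
  fixes \<xi> :: "real \<Rightarrow> real"
  assumes "c \<le> d" "p \<le> q"
  shows "\<xi> (max c (min d q)) - \<xi> (max c (min d p)) =
    (if {c..d} \<inter> {p..q} = {} then 0
     else \<xi> (Sup ({c..d} \<inter> {p..q})) - \<xi> (Inf ({c..d} \<inter> {p..q})))"
  using assms by (auto simp: max_def min_def)

lemma sum_increments_common_refinement_le: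
  fixes \<xi> :: "real \<Rightarrow> real"
  assumes P: "P division_of {a..b}" and Q: "Q division_of {a..b}"
    and V: "\<And>D. D division_of {a..b} \<Longrightarrow> (\<Sum>K\<in>D. \<bar>\<xi> (Sup K) - \<xi> (Inf K)\<bar>) \<le> V"
  shows "(\<Sum>(K, L)\<in>P \<times> Q. if K \<inter> L = {} then 0 else \<bar>\<xi> (Sup (K \<inter> L)) - \<xi> (Inf (K \<inter> L))\<bar>) \<le> V"
    (is "(\<Sum>(K, L)\<in>_. ?g K L) \<le> V")
proof -
  let ?S = "{(K, L) \<in> P \<times> Q. K \<inter> L \<noteq> {}}"
  let ?h = "\<lambda>(K, L). K \<inter> L"
  let ?\<Delta> = "\<lambda>K. \<bar>\<xi> (Sup K) - \<xi> (Inf K)\<bar>"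
  have fin: "finite P" "finite Q"
    using P Q by auto
  have im: "?h ` ?S = {K \<inter> L | K L. K \<in> P \<and> L \<in> Q \<and> K \<inter> L \<noteq> {}}"
    by force
  have "(\<Sum>(K, L)\<in>P \<times> Q. ?g K L) = (\<Sum>(K, L)\<in>?S. ?\<Delta> (K \<inter> L))"
    using fin by (intro sum.mono_neutral_cong_right) (auto split: if_splits)
  also have "\<dots> = sum ?\<Delta> (?h ` ?S)"
  proof (subst sum.reindex_nontrivial)
    show "finite ?S"
      using fin by (auto intro: finite_subset[of _ "P \<times> Q"])
  next
    \<comment> \<open>Two different pairs of cells can have the same intersection only if it is a single point.\<close>
    fix A B assume AB: "A \<in> ?S" "B \<in> ?S" "A \<noteq> B" "?h A = ?h B"
    obtain K L K' L' where eq: "A = (K, L)" "B = (K', L')"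
      by fastforce
    have mem: "K \<in> P" "L \<in> Q" "K' \<in> P" "L' \<in> Q" "K \<inter> L \<noteq> {}" "K \<inter> L = K' \<inter> L'" "K \<noteq> K' \<or> L \<noteq> L'"
      using AB eq by auto
    obtain c d where K: "K = {c..d}"
      using division_ofD(4)[OF P mem(1)] by auto
    obtain p q where L: "L = {p..q}"
      using division_ofD(4)[OF Q mem(2)] by auto
    have KL: "K \<inter> L = {max c p..min d q}"
      using K L by (auto simp: Int_atLeastAtMost)
    have "interior (K \<inter> L) \<subseteq> interior K \<inter> interior K'" "interior (K \<inter> L) \<subseteq> interior L \<inter> interior L'"
      using interior_mono[of "K \<inter> L" K] interior_mono[of "K \<inter> L" K']
        interior_mono[of "K \<inter> L" L] interior_mono[of "K \<inter> L" L'] mem(6) by blast+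
    then have "interior (K \<inter> L) = {}"
      using division_ofD(5)[OF P mem(1,3)] division_ofD(5)[OF Q mem(2,4)] mem(7) by blast
    then have "max c p = min d q"
      using mem(5) KL by (auto simp: interior_atLeastAtMost_real max_def min_def split: if_splits)
    then show "?\<Delta> (?h A) = 0"
      using KL eq by simp
  qed (auto intro!: sum.cong)
  also have "\<dots> \<le> V"
    using V division_inter[OF P Q] im by simp
  finally show ?thesis .
qed

text \<open>
  Two Riemann--Stieltjes sums over fine tagged divisions are compared on the common refinement:
  both are sums over pairs of overlapping cells, and their tags lie within \<open>2 * \<delta>\<close> of each other.
\<close>

lemma RS_sums_close:
  fixes f \<xi> :: "real \<Rightarrow> real"
  assumes P: "P tagged_division_of {a..b}" and Q: "Q tagged_division_of {a..b}"
    and V: "\<And>D. D division_of {a..b} \<Longrightarrow> (\<Sum>K\<in>D. \<bar>\<xi> (Sup K) - \<xi> (Inf K)\<bar>) \<le> V"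
    and f: "\<And>x y. x \<in> {a..b} \<Longrightarrow> y \<in> {a..b} \<Longrightarrow> \<bar>x - y\<bar> < 2 * \<delta> \<Longrightarrow> \<bar>f x - f y\<bar> \<le> \<epsilon>"
    and fineP: "\<And>x K. (x, K) \<in> P \<Longrightarrow> diameter K < \<delta>"
    and fineQ: "\<And>x K. (x, K) \<in> Q \<Longrightarrow> diameter K < \<delta>"
    and \<epsilon>: "0 \<le> \<epsilon>"
  shows "\<bar>(\<Sum>(x, K)\<in>P. f x * (\<xi> (Sup K) - \<xi> (Inf K))) -
          (\<Sum>(x, K)\<in>Q. f x * (\<xi> (Sup K) - \<xi> (Inf K)))\<bar> \<le> \<epsilon> * V"
proof -
  define \<Delta> where "\<Delta> K L = \<xi> (max (Inf K) (min (Sup K) (Sup L))) - \<xi> (max (Inf K) (min (Sup K) (Inf L)))"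
    for K L :: "real set"
  define G where "G K L = (if K \<inter> L = {} then 0 else \<bar>\<xi> (Sup (K \<inter> L)) - \<xi> (Inf (K \<inter> L))\<bar>)"
    for K L :: "real set"
  have expand: "\<xi> (Sup K) - \<xi> (Inf K) = (\<Sum>(y, L)\<in>Q'. \<Delta> K L)"
    if "P' tagged_division_of {a..b}" "Q' tagged_division_of {a..b}" "(x, K) \<in> P'" for P' Q' x K
    unfolding \<Delta>_def by (rule tagged_cellE[OF that(1,3)]) (use increment_sum_clamped[OF that(2)] in auto)
  have G: "\<bar>\<Delta> K L\<bar> = G K L" and sym: "\<Delta> K L = \<Delta> L K"
    if mem: "(x, K) \<in> P" "(y, L) \<in> Q" for x y K L
  proof -
    obtain c d where K: "K = {c..d}" "c \<le> d"
      using tagged_cellE[OF P mem(1)] by (metis order_trans)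
    obtain p q where L: "L = {p..q}" "p \<le> q"
      using tagged_cellE[OF Q mem(2)] by (metis order_trans)
    show "\<Delta> K L = \<Delta> L K"
      using increment_clamped_symmetric[OF K(2) L(2)] K L by (simp add: \<Delta>_def)
    show "\<bar>\<Delta> K L\<bar> = G K L"
      using increment_clamped_Int[OF K(2) L(2), of \<xi>] K L by (simp add: \<Delta>_def G_def)
  qed
  have "(\<Sum>(x, K)\<in>P. f x * (\<xi> (Sup K) - \<xi> (Inf K))) = (\<Sum>(x, K)\<in>P. \<Sum>(y, L)\<in>Q. f x * \<Delta> K L)"
    by (intro sum.cong refl) (auto simp: expand[OF P Q] sum_distrib_left case_prod_unfold)
  moreover have "(\<Sum>(y, L)\<in>Q. f y * (\<xi> (Sup L) - \<xi> (Inf L))) = (\<Sum>(y, L)\<in>Q. \<Sum>(x, K)\<in>P. f y * \<Delta> L K)"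
    by (intro sum.cong refl) (auto simp: expand[OF Q P] sum_distrib_left case_prod_unfold)
  moreover have "(\<Sum>(y, L)\<in>Q. \<Sum>(x, K)\<in>P. f y * \<Delta> L K) = (\<Sum>(x, K)\<in>P. \<Sum>(y, L)\<in>Q. f y * \<Delta> K L)"
    unfolding case_prod_unfold by (subst sum.swap) (intro sum.cong refl, metis sym prod.collapse)
  ultimately have "\<bar>(\<Sum>(x, K)\<in>P. f x * (\<xi> (Sup K) - \<xi> (Inf K))) - (\<Sum>(x, K)\<in>Q. f x * (\<xi> (Sup K) - \<xi> (Inf K)))\<bar>
      = \<bar>\<Sum>(x, K)\<in>P. \<Sum>(y, L)\<in>Q. (f x - f y) * \<Delta> K L\<bar>"
    by (simp add: case_prod_unfold sum_subtractf left_diff_distrib)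
  also have "\<dots> \<le> (\<Sum>(x, K)\<in>P. \<Sum>(y, L)\<in>Q. \<bar>(f x - f y) * \<Delta> K L\<bar>)"
    unfolding case_prod_unfold by (intro order_trans[OF sum_abs] sum_mono) simp
  also have "\<dots> \<le> (\<Sum>(x, K)\<in>P. \<Sum>(y, L)\<in>Q. \<epsilon> * G K L)"
  proof (intro sum_mono, clarify, intro sum_mono, clarify)
    fix x K y L assume mem: "(x, K) \<in> P" "(y, L) \<in> Q"
    show "\<bar>(f x - f y) * \<Delta> K L\<bar> \<le> \<epsilon> * G K L"
    proof (cases "K \<inter> L = {}")
      case True
      then show ?thesis
        using G[OF mem] by (simp add: G_def)
    next
      case False
      then obtain z where z: "z \<in> K" "z \<in> L"
        by auto
      obtain c d where K: "K = {c..d}" "a \<le> c" "c \<le> x" "x \<le> d" "d \<le> b"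
        using tagged_cellE[OF P mem(1)] by metis
      obtain p q where L: "L = {p..q}" "a \<le> p" "p \<le> y" "y \<le> q" "q \<le> b"
        using tagged_cellE[OF Q mem(2)] by metis
      have "d - c < \<delta>" "q - p < \<delta>"
        using fineP[OF mem(1)] fineQ[OF mem(2)] K L by (auto split: if_splits)
      then have "\<bar>x - y\<bar> < 2 * \<delta>"
        using z K L by auto
      then have "\<bar>f x - f y\<bar> \<le> \<epsilon>"
        using f K L by auto
      then show ?thesis
        by (simp add: abs_mult G[OF mem] mult_right_mono G_def)
    qed
  qed
  also have "\<dots> = \<epsilon> * (\<Sum>(x, K)\<in>P. \<Sum>(y, L)\<in>Q. G K L)"
    by (simp add: sum_distrib_left case_prod_unfold)
  also have "(\<Sum>(x, K)\<in>P. \<Sum>(y, L)\<in>Q. G K L) = (\<Sum>K\<in>snd ` P. \<Sum>L\<in>snd ` Q. G K L)"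
  proof -
    have point: "G K {u} = 0" "G {u} K = 0" for K u
      by (auto simp: G_def)
    show ?thesis
      by (simp add: sum_over_tagged_cells[OF Q] sum_over_tagged_cells[OF P] point)
  qed
  also have "\<dots> = (\<Sum>(K, L)\<in>snd ` P \<times> snd ` Q. G K L)"
    by (simp add: sum.cartesian_product)
  also have "\<epsilon> * \<dots> \<le> \<epsilon> * V"
    unfolding G_def
    by (intro mult_left_mono \<epsilon> sum_increments_common_refinement_le[OF
          division_of_tagged_division[OF P] division_of_tagged_division[OF Q] V])
  finally show ?thesis .
qed

lemma RS_sum_abs_le:
  fixes f \<xi> :: "real \<Rightarrow> real"
  assumes P: "P tagged_division_of {a..b}"
    and bv: "bounded_variation_on a b \<xi>"
    and f: "\<And>x. x \<in> {a..b} \<Longrightarrow> \<bar>f x\<bar> \<le> M" and M: "0 \<le> M"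
  shows "\<bar>\<Sum>(x, K)\<in>P. f x * (\<xi> (Sup K) - \<xi> (Inf K))\<bar> \<le> M * total_variation a b \<xi>"
proof -
  have "\<bar>\<Sum>(x, K)\<in>P. f x * (\<xi> (Sup K) - \<xi> (Inf K))\<bar> \<le> (\<Sum>(x, K)\<in>P. \<bar>f x * (\<xi> (Sup K) - \<xi> (Inf K))\<bar>)"
    unfolding case_prod_unfold by (rule sum_abs)
  also have "\<dots> \<le> (\<Sum>(x, K)\<in>P. M * \<bar>\<xi> (Sup K) - \<xi> (Inf K)\<bar>)"
    using tagged_division_ofD(2,3)[OF P]
    by (intro sum_mono) (fastforce simp: abs_mult intro!: mult_right_mono f)
  also have "\<dots> = M * (\<Sum>(x, K)\<in>P. \<bar>\<xi> (Sup K) - \<xi> (Inf K)\<bar>)"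
    by (simp add: sum_distrib_left case_prod_unfold)
  also have "(\<Sum>(x, K)\<in>P. \<bar>\<xi> (Sup K) - \<xi> (Inf K)\<bar>) = (\<Sum>K\<in>snd ` P. \<bar>\<xi> (Sup K) - \<xi> (Inf K)\<bar>)"
    by (rule sum_over_tagged_cells[OF P]) simp
  also have "\<dots> \<le> total_variation a b \<xi>"
    unfolding total_variation_def
    using bv division_of_tagged_division[OF P]
    by (intro cSup_upper) (auto simp: variation_sums_def bounded_variation_on_def)
  finally show ?thesis
    using M by (simp add: mult_left_mono)
qed

lemma fine_tagged_division_exists:
  fixes a b \<delta> :: real
  assumes "0 < \<delta>"
  obtains P where "P tagged_division_of {a..b}" "\<And>x K. (x, K) \<in> P \<Longrightarrow> diameter K < \<delta>"
proof -
  have "gauge (\<lambda>x :: real. ball x (\<delta> / 3))"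
    using assms by (intro gauge_ball) simp
  then obtain P where P: "P tagged_division_of {a..b}" "(\<lambda>x. ball x (\<delta> / 3)) fine P"
    by (rule fine_division_exists_real)
  have "diameter K < \<delta>" if mem: "(x, K) \<in> P" for x K
  proof -
    obtain c d where K: "K = {c..d}" "c \<le> x" "x \<le> d"
      using tagged_cellE[OF P(1) mem] by metis
    then have "c \<in> ball x (\<delta> / 3)" "d \<in> ball x (\<delta> / 3)"
      using fineD[OF P(2) mem] by fastforce+
    then show ?thesis
      using K by (auto simp: dist_real_def)
  qed
  then show ?thesis
    using that P(1) by blast
qed

lemma has_RS_integral_unique:
  assumes "has_RS_integral f \<xi> a b I" "has_RS_integral f \<xi> a b J"
  shows "I = J"
proof (rule ccontr)
  assume "I \<noteq> J"
  then have pos: "0 < \<bar>I - J\<bar> / 2"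
    by simp
  let ?S = "\<lambda>P. \<Sum>(x, K)\<in>P. f x * (\<xi> (Sup K) - \<xi> (Inf K))"
  obtain \<delta>1 where d1: "0 < \<delta>1" "\<And>P. P tagged_division_of {a..b} \<Longrightarrow> (\<forall>(x, K)\<in>P. diameter K < \<delta>1)
      \<Longrightarrow> \<bar>?S P - I\<bar> < \<bar>I - J\<bar> / 2"
    using assms(1) pos unfolding has_RS_integral_def by meson
  obtain \<delta>2 where d2: "0 < \<delta>2" "\<And>P. P tagged_division_of {a..b} \<Longrightarrow> (\<forall>(x, K)\<in>P. diameter K < \<delta>2)
      \<Longrightarrow> \<bar>?S P - J\<bar> < \<bar>I - J\<bar> / 2"
    using assms(2) pos unfolding has_RS_integral_def by meson
  obtain P where P: "P tagged_division_of {a..b}" "\<And>x K. (x, K) \<in> P \<Longrightarrow> diameter K < min \<delta>1 \<delta>2"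
    using fine_tagged_division_exists[of "min \<delta>1 \<delta>2" a b] d1(1) d2(1) by (metis min_less_iff_conj)
  have "\<bar>?S P - I\<bar> < \<bar>I - J\<bar> / 2" "\<bar>?S P - J\<bar> < \<bar>I - J\<bar> / 2"
    using d1(2)[OF P(1)] d2(2)[OF P(1)] P(2) by auto
  then have "\<bar>I - J\<bar> < \<bar>I - J\<bar> / 2 + \<bar>I - J\<bar> / 2"
    using abs_triangle_ineq[of "I - ?S P" "?S P - J"] by (simp add: abs_minus_commute)
  then show False
    by simp
qed

text \<open>
  A continuous integrand has a Riemann--Stieltjes integral against every integrator of bounded
  variation: the sums over ever finer divisions form a Cauchy sequence.
\<close>

lemma has_RS_integral_RS_integral:
  fixes f \<xi> :: "real \<Rightarrow> real"
  assumes f: "continuous_on {a..b} f" and bv: "bounded_variation_on a b \<xi>"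
  shows "has_RS_integral f \<xi> a b (RS_integral a b f \<xi>)"
proof -
  define S where "S P = (\<Sum>(x, K)\<in>P. f x * (\<xi> (Sup K) - \<xi> (Inf K)))" for P
  obtain V0 where V0: "\<And>s. s \<in> variation_sums a b \<xi> \<Longrightarrow> s \<le> V0"
    using bv unfolding bounded_variation_on_def bdd_above_def by auto
  define V where "V = max V0 1"
  have V: "0 < V" "(\<Sum>K\<in>D. \<bar>\<xi> (Sup K) - \<xi> (Inf K)\<bar>) \<le> V" if "D division_of {a..b}" for D
    using V0[of "\<Sum>K\<in>D. \<bar>\<xi> (Sup K) - \<xi> (Inf K)\<bar>"] that
    by (auto simp: V_def variation_sums_def intro: max.coboundedI1)
  have Vpos: "0 < V"
    by (simp add: V_def)
  define fine_div where "fine_div \<delta> P \<longleftrightarrow> P tagged_division_of {a..b} \<and> (\<forall>(x, K)\<in>P. diameter K < \<delta>)" for \<delta> P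
  have close: "\<exists>\<delta>>0. \<forall>P Q. fine_div \<delta> P \<longrightarrow> fine_div \<delta> Q \<longrightarrow> \<bar>S P - S Q\<bar> < \<epsilon>"
    if "0 < \<epsilon>" for \<epsilon>
  proof -
    have "uniformly_continuous_on {a..b} f"
      using f by (simp add: compact_uniformly_continuous)
    moreover have "0 < \<epsilon> / (2 * V)"
      using that Vpos by simp
    ultimately obtain \<delta> where \<delta>: "0 < \<delta>" "\<And>x y. x \<in> {a..b} \<Longrightarrow> y \<in> {a..b} \<Longrightarrow> dist y x < \<delta> \<Longrightarrow> dist (f y) (f x) < \<epsilon> / (2 * V)"
      unfolding uniformly_continuous_on_def by meson
    show ?thesis
    proof (rule exI[of _ "\<delta> / 2"], intro conjI allI impI, goal_cases)
      case 1
      show ?case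
        using \<delta>(1) by simp
    next
      case (2 P Q)
      have "\<bar>S P - S Q\<bar> \<le> (\<epsilon> / (2 * V)) * V"
        unfolding S_def
      proof (rule RS_sums_close[where \<delta> = "\<delta> / 2"])
        show "\<bar>f x - f y\<bar> \<le> \<epsilon> / (2 * V)" if "x \<in> {a..b}" "y \<in> {a..b}" "\<bar>x - y\<bar> < 2 * (\<delta> / 2)" for x y
          using \<delta>(2)[OF that(2,1)] that(3) by (simp add: dist_real_def)
      qed (use 2 V that Vpos in \<open>auto simp: fine_div_def\<close>)
      also have "\<dots> < \<epsilon>"
        using Vpos that by (simp add: field_simps)
      finally show ?case .
    qed
  qed
  have "\<exists>P. fine_div (inverse (real (Suc n))) P" for n
  proof -
    have "0 < inverse (real (Suc n))"
      by simp
    then obtain P where "P tagged_division_of {a..b}" "\<And>x K. (x, K) \<in> P \<Longrightarrow> diameter K < inverse (real (Suc n))"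
      using fine_tagged_division_exists[of _ a b] by metis
    then have "fine_div (inverse (real (Suc n))) P"
      unfolding fine_div_def by auto
    then show ?thesis ..
  qed
  then obtain P where P: "\<And>n. fine_div (inverse (real (Suc n))) (P n)"
    by metis
  have small: "\<forall>\<^sub>F n in sequentially. fine_div \<delta> (P n)" if "0 < \<delta>" for \<delta>
  proof -
    have "\<forall>\<^sub>F n in sequentially. inverse (real (Suc n)) < \<delta>"
      using order_tendstoD(2)[OF LIMSEQ_inverse_real_of_nat that] .
    then show ?thesis
    proof eventually_elim
      case (elim n)
      then show ?case
        using P[of n] less_trans unfolding fine_div_def by blast
    qed
  qed
  have "Cauchy (\<lambda>n. S (P n))"
  proof (rule metric_CauchyI)
    fix \<epsilon> :: real assume "0 < \<epsilon>"
    then obtain \<delta> where \<delta>: "0 < \<delta>" "\<And>P Q. fine_div \<delta> P \<Longrightarrow> fine_div \<delta> Q \<Longrightarrow> \<bar>S P - S Q\<bar> < \<epsilon>"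
      using close by metis
    obtain N where N: "\<And>n. n \<ge> N \<Longrightarrow> fine_div \<delta> (P n)"
      using small[OF \<delta>(1)] unfolding eventually_sequentially by metis
    show "\<exists>N. \<forall>m\<ge>N. \<forall>n\<ge>N. dist (S (P m)) (S (P n)) < \<epsilon>"
      unfolding dist_real_def by (intro exI[of _ N] allI impI \<delta>(2) N)
  qed
  then obtain I where I: "(\<lambda>n. S (P n)) \<longlonglongrightarrow> I"
    using Cauchy_convergent convergent_def by blast
  have "has_RS_integral f \<xi> a b I"
    unfolding has_RS_integral_def fine_div_def[symmetric] S_def[symmetric]
  proof (intro allI impI)
    fix \<epsilon> :: real assume "0 < \<epsilon>"
    then have "0 < \<epsilon> / 2"
      by simp
    then obtain \<delta> where \<delta>: "0 < \<delta>" "\<And>P Q. fine_div \<delta> P \<Longrightarrow> fine_div \<delta> Q \<Longrightarrow> \<bar>S P - S Q\<bar> < \<epsilon> / 2"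
      using close by metis
    have "\<bar>S Q - I\<bar> < \<epsilon>" if Q: "fine_div \<delta> Q" for Q
    proof -
      have "\<forall>\<^sub>F n in sequentially. \<bar>S Q - S (P n)\<bar> \<le> \<epsilon> / 2"
        using small[OF \<delta>(1)] by eventually_elim (intro less_imp_le \<delta>(2) Q)
      moreover have "(\<lambda>n. \<bar>S Q - S (P n)\<bar>) \<longlonglongrightarrow> \<bar>S Q - I\<bar>"
        by (intro tendsto_intros I)
      ultimately have "\<bar>S Q - I\<bar> \<le> \<epsilon> / 2"
        using tendsto_upperbound sequentially_bot by blast
      then show ?thesis
        using \<open>0 < \<epsilon>\<close> by simp
    qed
    then show "\<exists>\<delta>>0. \<forall>P. fine_div \<delta> P \<longrightarrow> \<bar>S P - I\<bar> < \<epsilon>"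
      using \<delta>(1) by (intro exI[of _ \<delta>]) simp
  qed
  moreover from this have "RS_integral a b f \<xi> = I"
    unfolding RS_integral_def by (intro the_equality) (auto dest: has_RS_integral_unique)
  ultimately show ?thesis
    by simp
qed

lemma RS_integral_limit_sums:
  assumes f: "continuous_on {a..b} f" and bv: "bounded_variation_on a b \<xi>" and "0 < \<epsilon>"
  obtains P where "P tagged_division_of {a..b}"
    "\<bar>(\<Sum>(x, K)\<in>P. f x * (\<xi> (Sup K) - \<xi> (Inf K))) - RS_integral a b f \<xi>\<bar> < \<epsilon>"
proof -
  obtain \<delta> where \<delta>: "0 < \<delta>" "\<And>P. P tagged_division_of {a..b} \<Longrightarrow> (\<forall>(x, K)\<in>P. diameter K < \<delta>) \<Longrightarrow>
      \<bar>(\<Sum>(x, K)\<in>P. f x * (\<xi> (Sup K) - \<xi> (Inf K))) - RS_integral a b f \<xi>\<bar> < \<epsilon>"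
    using has_RS_integral_RS_integral[OF f bv] \<open>0 < \<epsilon>\<close> unfolding has_RS_integral_def by meson
  obtain P where "P tagged_division_of {a..b}" "\<And>x K. (x, K) \<in> P \<Longrightarrow> diameter K < \<delta>"
    using fine_tagged_division_exists[OF \<delta>(1)] by blast
  then show ?thesis
    using that \<delta>(2) by blast
qed

lemma RS_integral_abs_le:
  assumes f: "continuous_on {a..b} f" and bv: "bounded_variation_on a b \<xi>"
    and M: "\<And>x. x \<in> {a..b} \<Longrightarrow> \<bar>f x\<bar> \<le> M" "0 \<le> M"
  shows "\<bar>RS_integral a b f \<xi>\<bar> \<le> M * total_variation a b \<xi>"
proof (rule field_le_epsilon)
  fix \<epsilon> :: real assume "0 < \<epsilon>"
  then obtain P where "P tagged_division_of {a..b}"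
    "\<bar>(\<Sum>(x, K)\<in>P. f x * (\<xi> (Sup K) - \<xi> (Inf K))) - RS_integral a b f \<xi>\<bar> < \<epsilon>"
    by (rule RS_integral_limit_sums[OF f bv])
  moreover from this(1) have "\<bar>\<Sum>(x, K)\<in>P. f x * (\<xi> (Sup K) - \<xi> (Inf K))\<bar> \<le> M * total_variation a b \<xi>"
    by (rule RS_sum_abs_le[OF _ bv M])
  ultimately show "\<bar>RS_integral a b f \<xi>\<bar> \<le> M * total_variation a b \<xi> + \<epsilon>"
    by linarith
qed

lemma total_variation_mono_on:
  assumes "a \<le> b" "mono_on {a..b} \<xi>"
  shows "total_variation a b \<xi> = \<xi> b - \<xi> a"
proof -
  have eq: "(\<Sum>K\<in>D. \<bar>\<xi> (Sup K) - \<xi> (Inf K)\<bar>) = \<xi> b - \<xi> a" if D: "D division_of {a..b}" for D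
  proof -
    have cell: "\<exists>c d. K = {c..d} \<and> c \<le> d \<and> a \<le> c \<and> d \<le> b" if mem: "K \<in> D" for K
    proof -
      obtain c d where "K = {c..d}"
        using division_ofD(4)[OF D mem] by auto
      then show ?thesis
        using division_ofD(2,3)[OF D mem] by auto
    qed
    let ?P = "(\<lambda>K. (Inf K, K)) ` D"
    have P: "?P tagged_division_of {a..b}"
    proof (rule tagged_division_ofI)
      show "finite ?P"
        using division_ofD(1)[OF D] by simp
      show "\<Union>{K. \<exists>x. (x, K) \<in> ?P} = {a..b}"
        using division_ofD(6)[OF D] by (auto simp: image_iff)
      fix x K assume "(x, K) \<in> ?P"
      then have K: "K \<in> D" "x = Inf K"
        by auto
      obtain c d where "K = {c..d}" "c \<le> d" "a \<le> c" "d \<le> b"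
        using cell[OF K(1)] by blast
      then show "x \<in> K" "K \<subseteq> {a..b}" "\<exists>c d. K = cbox c d"
        using K(2) by auto
    next
      fix x K x' K' assume "(x, K) \<in> ?P" "(x', K') \<in> ?P" "(x, K) \<noteq> (x', K')"
      then show "interior K \<inter> interior K' = {}"
        using division_ofD(5)[OF D] by blast
    qed
    have "(\<Sum>K\<in>D. \<bar>\<xi> (Sup K) - \<xi> (Inf K)\<bar>) = (\<Sum>K\<in>D. \<xi> (Sup K) - \<xi> (Inf K))"
    proof (intro sum.cong refl)
      fix K assume "K \<in> D"
      then obtain c d where K: "K = {c..d}" "c \<le> d" "a \<le> c" "d \<le> b"
        using cell by blast
      then have "\<xi> c \<le> \<xi> d"
        by (intro mono_onD[OF assms(2)]) auto
      with K show "\<bar>\<xi> (Sup K) - \<xi> (Inf K)\<bar> = \<xi> (Sup K) - \<xi> (Inf K)"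
        by simp
    qed
    also have "\<dots> = (\<Sum>(x, K)\<in>?P. \<xi> (Sup K) - \<xi> (Inf K))"
      by (subst sum.reindex) (auto simp: inj_on_def)
    also have "\<dots> = \<xi> b - \<xi> a"
      by (rule additive_tagged_division_1[OF assms(1) P])
    finally show ?thesis .
  qed
  have "{{a..b}} division_of {a..b}"
    using assms(1) division_of_self[of a b] by simp
  then have "\<exists>D. D division_of {a..b}" ..
  then have "variation_sums a b \<xi> = {\<xi> b - \<xi> a}"
    unfolding variation_sums_def by (auto simp: eq) (metis eq)
  then show ?thesis
    by (simp add: total_variation_def)
qed

lemma RS_integral_mono_on_bounds:
  assumes f: "continuous_on {a..b} f" and bv: "bounded_variation_on a b \<xi>"
    and ab: "a \<le> b" and mono: "mono_on {a..b} \<xi>" and tv: "total_variation a b \<xi> = 1"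
  shows "(\<And>x. x \<in> {a..b} \<Longrightarrow> m \<le> f x) \<Longrightarrow> m \<le> RS_integral a b f \<xi>"
    and "(\<And>x. x \<in> {a..b} \<Longrightarrow> f x \<le> m) \<Longrightarrow> RS_integral a b f \<xi> \<le> m"
proof -
  have incr: "\<xi> b - \<xi> a = 1"
    using total_variation_mono_on[OF ab mono] tv by simp
  have const: "(\<Sum>(x, K)\<in>P. m * (\<xi> (Sup K) - \<xi> (Inf K))) = m" if "P tagged_division_of {a..b}" for P
    using additive_tagged_division_1[OF ab that, of \<xi>] incr
    by (simp add: case_prod_unfold flip: sum_distrib_left)
  have pos: "0 \<le> \<xi> (Sup K) - \<xi> (Inf K)" "x \<in> {a..b}" if mem: "P tagged_division_of {a..b}" "(x, K) \<in> P" for P x K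
  proof -
    obtain c d where K: "K = {c..d}" "a \<le> c" "c \<le> x" "x \<le> d" "d \<le> b"
      using tagged_cellE[OF mem] by metis
    then show "x \<in> {a..b}"
      by auto
    have "\<xi> c \<le> \<xi> d"
      using K by (intro mono_onD[OF mono]) auto
    then show "0 \<le> \<xi> (Sup K) - \<xi> (Inf K)"
      using K by simp
  qed
  show "m \<le> RS_integral a b f \<xi>" if m: "\<And>x. x \<in> {a..b} \<Longrightarrow> m \<le> f x"
  proof (rule field_le_epsilon)
    fix \<epsilon> :: real assume "0 < \<epsilon>"
    then obtain P where P: "P tagged_division_of {a..b}"
      "\<bar>(\<Sum>(x, K)\<in>P. f x * (\<xi> (Sup K) - \<xi> (Inf K))) - RS_integral a b f \<xi>\<bar> < \<epsilon>"
      by (rule RS_integral_limit_sums[OF f bv])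
    have "(\<Sum>(x, K)\<in>P. m * (\<xi> (Sup K) - \<xi> (Inf K))) \<le> (\<Sum>(x, K)\<in>P. f x * (\<xi> (Sup K) - \<xi> (Inf K)))"
      using pos[OF P(1)] m by (intro sum_mono) (auto intro!: mult_right_mono)
    then show "m \<le> RS_integral a b f \<xi> + \<epsilon>"
      using const[OF P(1)] P(2) by linarith
  qed
  show "RS_integral a b f \<xi> \<le> m" if m: "\<And>x. x \<in> {a..b} \<Longrightarrow> f x \<le> m"
  proof (rule field_le_epsilon)
    fix \<epsilon> :: real assume "0 < \<epsilon>"
    then obtain P where P: "P tagged_division_of {a..b}"
      "\<bar>(\<Sum>(x, K)\<in>P. f x * (\<xi> (Sup K) - \<xi> (Inf K))) - RS_integral a b f \<xi>\<bar> < \<epsilon>"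
      by (rule RS_integral_limit_sums[OF f bv])
    have "(\<Sum>(x, K)\<in>P. f x * (\<xi> (Sup K) - \<xi> (Inf K))) \<le> (\<Sum>(x, K)\<in>P. m * (\<xi> (Sup K) - \<xi> (Inf K)))"
      using pos[OF P(1)] m by (intro sum_mono) (auto intro!: mult_right_mono)
    then show "RS_integral a b f \<xi> \<le> m + \<epsilon>"
      using const[OF P(1)] P(2) by linarith
  qed
qed

section \<open>A scalar inequality with averaged delay\<close>

text \<open>
  The function \<open>H\<close> is the intrinsic time of the equation, and \<open>d\<close> the speed of that clock. Hypothesis
  \<open>drift\<close> says that the history enters \<open>z'\<close> through an average whose mean
  delay in intrinsic time, together with the strength \<open>\<theta>\<close> of the forcing, is at most \<open>\<beta> < 1\<close>.
  Estimating the delayed values by the crude Lipschitz constant \<open>1 + \<theta>\<close> of \<open>z\<close> would need more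
  than that. Instead let \<open>L\<close> be the largest slope of a chord of \<open>z\<close> (over intrinsic time)
  ending at \<open>t\<close>. If \<open>L \<le> 1\<close>, then \<open>drift\<close> with the line of slope \<open>1\<close> through the end point is
  the claim. If \<open>L > 1\<close>, then the line of slope \<open>L\<close> bounds the whole history from below, and
  the convex combination of the two available bounds for \<open>z'\<close> that eliminates \<open>\<theta>\<close> gives
  \<open>z' \<le> d (w + \<kappa>)\<close> at intrinsic distance \<open>w\<close> from \<open>t\<close>; hence every slope \<open>s\<close> satisfies
  \<open>s \<le> w / 2 + \<kappa>\<close> and \<open>s w \<le> 1 + z t\<close>. The largest slope then satisfies a quadratic inequality
  that has no real solution.
\<close>

lemma averaged_delay_decay:
  fixes z z' H d \<theta> :: "real \<Rightarrow> real" and \<beta> r A t :: real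
  assumes \<beta>: "\<beta> < 1" and r: "0 \<le> r" and At: "A \<le> t"
    and \<theta>: "\<And>u. u \<in> {A..t} \<Longrightarrow> \<theta> u \<le> \<beta>"
    and d: "\<And>u. u \<in> {A..t} \<Longrightarrow> 0 < d u"
    and H: "\<And>u. u \<in> {A..t} \<Longrightarrow> (H has_real_derivative d u) (at u)"
    and H_mono: "strict_mono_on {A - r..t} H"
    and H_long: "2 \<le> H t - H A"
    and z: "\<And>u. u \<in> {A..t} \<Longrightarrow> (z has_real_derivative z' u) (at u)"
    and z_lower: "\<And>u. u \<in> {A - r..t} \<Longrightarrow> - 1 \<le> z u"
    and drift: "\<And>u c L. u \<in> {A..t} \<Longrightarrow> 0 \<le> L \<Longrightarrow>
        (\<And>w. w \<in> {u - r..u} \<Longrightarrow> c - L * (H u - H w) \<le> z w) \<Longrightarrow>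
        z' u \<le> d u * (\<theta> u - c + L * (\<beta> - \<theta> u))"
    and zt: "\<beta> < z t" "z t \<le> 1"
  shows "z' t \<le> d t * (\<beta> - z t)"
proof -
  define \<rho> where "\<rho> = z t"
  define slope where "slope u = (\<rho> - z u) / (H t - H u)" for u
  define \<S> where "\<S> = slope ` {A - r..<t}"
  have "A \<noteq> t"
    using H_long by auto
  with At have At': "A < t"
    by simp
  have pos: "0 < H t - H u" if "u \<in> {A - r..<t}" for u
    using strict_mono_onD[OF H_mono, of u t] that by auto
  have crude: "z' u \<le> d u * (1 + \<theta> u)" if u: "u \<in> {A..t}" for u
    using drift[OF u, of 0 "-1"] z_lower u by (simp add: add.commute)
  \<comment> \<open>Chords that reach back beyond \<open>A\<close> are long and therefore flat.\<close>
  have early: "slope u \<le> 1" if u: "u \<in> {A - r..<A}" for u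
  proof -
    have "H u < H A"
      using strict_mono_onD[OF H_mono, of u A] u At' r by auto
    then have "\<rho> - z u \<le> H t - H u"
      using z_lower[of u] u At' zt(2) H_long by (auto simp: \<rho>_def)
    then show ?thesis
      using pos[of u] u At' by (auto simp: slope_def)
  qed
  have chord_bound: "slope u \<le> B"
    if u: "u \<in> {A..<t}" and B: "\<rho> - z u \<le> B * (H t - H u)" for u B
    using pos[of u] u r B by (simp add: slope_def pos_divide_le_eq)
  have integrate: "\<rho> - z u \<le> \<gamma> / 2 * (H t - H u)^2 + \<kappa> * (H t - H u)"
    if u: "u \<in> {A..<t}" and bound: "\<And>w. w \<in> {A..t} \<Longrightarrow> z' w \<le> d w * (\<gamma> * (H t - H w) + \<kappa>)" for u \<gamma> \<kappa>
  proof -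
    define \<Phi> where "\<Phi> w = z w + \<gamma> / 2 * (H t - H w)^2 + \<kappa> * (H t - H w)" for w
    have "\<Phi> t \<le> \<Phi> u"
    proof (rule DERIV_nonpos_imp_nonincreasing[of u t \<Phi>])
      show "u \<le> t"
        using u by simp
      fix w assume "u \<le> w" "w \<le> t"
      then have w: "w \<in> {A..t}"
        using u by simp
      have "(\<Phi> has_real_derivative z' w - d w * (\<gamma> * (H t - H w) + \<kappa>)) (at w)"
        unfolding \<Phi>_def
        by (rule derivative_eq_intros z[OF w] H[OF w] refl)+ (simp add: field_simps)
      then show "\<exists>y. (\<Phi> has_real_derivative y) (at w) \<and> y \<le> 0"
        using bound[OF w] by (intro exI conjI) auto
    qed
    then show ?thesis
      by (simp add: \<Phi>_def \<rho>_def)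
  qed
  have "slope u \<le> 2" if u: "u \<in> {A - r..<t}" for u
  proof (cases "u < A")
    case True
    then show ?thesis
      using early[of u] u by simp
  next
    case False
    have "z' w \<le> d w * (0 * (H t - H w) + 2)" if w: "w \<in> {A..t}" for w
      using crude[OF w] \<theta>[OF w] \<beta> d[OF w] by (intro order_trans[OF crude[OF w]] mult_left_mono) auto
    then show ?thesis
      using integrate[of u 0 2] u False by (intro chord_bound) auto
  qed
  then have bdd: "bdd_above \<S>"
    unfolding \<S>_def by (intro bdd_aboveI2[where M = 2])
  have ne: "\<S> \<noteq> {}"
    using At' r by (auto simp: \<S>_def)
  define L where "L = max 1 (Sup \<S>)"
  have line: "\<rho> - L * (H t - H u) \<le> z u" if u: "u \<in> {A - r..t}" for u
  proof (cases "u = t")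
    case True
    then show ?thesis
      by (simp add: \<rho>_def)
  next
    case False
    then have u': "u \<in> {A - r..<t}"
      using u by auto
    then have "slope u \<le> L"
      using bdd by (auto simp: L_def \<S>_def intro!: max.coboundedI2 cSup_upper)
    then show ?thesis
      using pos[OF u'] by (simp add: slope_def pos_divide_le_eq)
  qed
  have at_t: "z' t \<le> d t * (\<theta> t - \<rho> + L * (\<beta> - \<theta> t))"
    using At line by (intro drift) (auto simp: L_def)
  show ?thesis
  proof (cases "Sup \<S> \<le> 1")
    case True
    then show ?thesis
      using at_t by (simp add: L_def \<rho>_def algebra_simps)
  next
    case False
    then have L: "1 < L" "L = Sup \<S>"
      by (auto simp: L_def)
    define \<kappa> where "\<kappa> = 1 + \<beta> - (1 + \<rho>) / L"
    have \<kappa>_L: "\<kappa> * L = (1 + \<beta>) * L - (1 + \<rho>)"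
      using L by (simp add: \<kappa>_def field_simps)
    have "z' u \<le> d u * (1 * (H t - H u) + \<kappa>)" if u: "u \<in> {A..t}" for u
    proof -
      have "z' u \<le> d u * (\<theta> u - (\<rho> - L * (H t - H u)) + L * (\<beta> - \<theta> u))"
      proof (rule drift[OF u])
        fix w assume "w \<in> {u - r..u}"
        then show "\<rho> - L * (H t - H u) - L * (H u - H w) \<le> z w"
          using line[of w] u by (simp add: algebra_simps)
      qed (use L in simp)
      moreover have "(L - 1) * z' u \<le> (L - 1) * (d u * (1 + \<theta> u))"
        using L crude[OF u] by (intro mult_left_mono) auto
      \<comment> \<open>With the weights \<open>1\<close> and \<open>L - 1\<close>, the contributions of \<open>\<theta> u\<close> cancel.\<close>
      ultimately have "L * z' u \<le> d u * (\<theta> u - (\<rho> - L * (H t - H u)) + L * (\<beta> - \<theta> u)) + (L - 1) * (d u * (1 + \<theta> u))"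
        by (simp add: algebra_simps)
      also have "\<dots> = d u * (L * (H t - H u)) + d u * (\<kappa> * L)"
        unfolding \<kappa>_L by (simp add: algebra_simps)
      also have "\<dots> = L * (d u * (1 * (H t - H u) + \<kappa>))"
        by (simp add: algebra_simps)
      finally show ?thesis
        using L by simp
    qed
    note steep = integrate[OF _ this]
    have "s \<le> 1 \<or> s\<^sup>2 - \<kappa> * s \<le> (1 + \<rho>) / 2" if s: "s \<in> \<S>" for s
    proof (cases "s \<le> 1")
      case False
      obtain u where u: "s = slope u" "u \<in> {A - r..<t}"
        using s by (auto simp: \<S>_def)
      then have uA: "u \<in> {A..<t}"
        using early[of u] False by force
      define w where "w = H t - H u"
      have w: "0 < w"
        using pos[OF u(2)] by (simp add: w_def)
      have sw: "s * w = \<rho> - z u"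
        using w by (simp add: u(1) slope_def w_def)
      have "s * w \<le> 1 + \<rho>"
        using z_lower[of u] u(2) sw by auto
      moreover have "s * w \<le> (w / 2 + \<kappa>) * w"
        using steep[OF uA] unfolding sw[symmetric] w_def[symmetric]
        by (simp add: power2_eq_square algebra_simps)
      then have "s \<le> w / 2 + \<kappa>"
        using w by simp
      then have "s * s \<le> s * (w / 2 + \<kappa>)"
        using False by (intro mult_left_mono) auto
      ultimately show ?thesis
        by (simp add: power2_eq_square algebra_simps)
    qed simp
    then have "\<S> \<subseteq> {s. s \<le> 1} \<union> {s. s\<^sup>2 - \<kappa> * s \<le> (1 + \<rho>) / 2}"
      by auto
    moreover have "closed ({s. s \<le> 1} \<union> {s. s\<^sup>2 - \<kappa> * s \<le> (1 + \<rho>) / 2})"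
      by (intro closed_Un closed_Collect_le continuous_intros)
    ultimately have "L \<in> {s. s \<le> 1} \<union> {s. s\<^sup>2 - \<kappa> * s \<le> (1 + \<rho>) / 2}"
      unfolding L(2) using closed_subset_contains_Sup bdd ne by blast
    then have "L\<^sup>2 - \<kappa> * L \<le> (1 + \<rho>) / 2"
      using L by auto
    then have quad: "L\<^sup>2 - (1 + \<beta>) * L + (1 + \<rho>) / 2 \<le> 0"
      unfolding \<kappa>_L by (simp add: field_simps)
    have "- 1 \<le> \<rho>"
      using z_lower[of t] At' r by (simp add: \<rho>_def)
    \<comment> \<open>The discriminant is \<open>(1 + \<beta>)\<^sup>2 - 2 (1 + \<rho>) < 0\<close>, because \<open>\<beta> < \<rho>\<close> and \<open>\<beta> < 1\<close>.\<close>
    have "0 < L\<^sup>2 - (1 + \<beta>) * L + (1 + \<rho>) / 2"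
    proof (cases "1 + \<beta> \<le> 0")
      case True
      then have "(1 + \<beta>) * L \<le> 0"
        using L by (simp add: mult_le_0_iff)
      also have "0 < L\<^sup>2"
        using L by simp
      finally have "0 < L\<^sup>2 - (1 + \<beta>) * L"
        by (simp only: diff_gt_0_iff_gt)
      then show ?thesis
        using \<open>- 1 \<le> \<rho>\<close> by (intro add_pos_nonneg) auto
    next
      case False
      then have "(1 + \<beta>) * (1 + \<beta>) < (1 + \<rho>) * 2"
        using \<beta> zt(1) by (intro mult_strict_mono) (auto simp: \<rho>_def)
      moreover have "0 \<le> (L - (1 + \<beta>) / 2)\<^sup>2"
        by simp
      ultimately show ?thesis
        by (simp add: power2_eq_square field_simps)
    qed
    with quad show ?thesis
      by simp
  qed
qed

text \<open>
  The bound \<open>z' \<le> d (\<beta> - z)\<close> above the level \<open>\<beta>\<close> pulls \<open>z\<close> below any level \<open>q > \<beta>\<close> within a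
  fixed amount of intrinsic time, and it prevents \<open>z\<close> from crossing \<open>q\<close> upwards again.
\<close>

lemma relaxation_below_level:
  fixes z z' H d :: "real \<Rightarrow> real" and \<beta> q A t :: real
  assumes q: "\<beta> < q" and At: "A \<le> t"
    and d: "\<And>u. u \<in> {A..t} \<Longrightarrow> 0 < d u"
    and H: "\<And>u. u \<in> {A..t} \<Longrightarrow> (H has_real_derivative d u) (at u)"
    and z: "\<And>u. u \<in> {A..t} \<Longrightarrow> (z has_real_derivative z' u) (at u)"
    and decay: "\<And>u. u \<in> {A..t} \<Longrightarrow> \<beta> < z u \<Longrightarrow> z' u \<le> d u * (\<beta> - z u)"
    and start: "z A \<le> 1" and long: "1 \<le> q + (q - \<beta>) * (H t - H A)"
  shows "z t \<le> q"
proof (rule ccontr)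
  assume above: "\<not> z t \<le> q"
  have decrease: "z t + (q - \<beta>) * (H t - H a) \<le> z a"
    if a: "a \<in> {A..t}" "\<And>u. u \<in> {a<..t} \<Longrightarrow> q \<le> z u" "q \<le> z a" for a
  proof -
    define \<Phi> where "\<Phi> u = z u + (q - \<beta>) * H u" for u
    have "\<Phi> t \<le> \<Phi> a"
    proof (rule DERIV_nonpos_imp_nonincreasing[of a t \<Phi>])
      show "a \<le> t"
        using a by simp
      fix u assume u: "a \<le> u" "u \<le> t"
      then have uA: "u \<in> {A..t}" and zu: "q \<le> z u"
        using a by (auto simp: order.order_iff_strict)
      have "(\<Phi> has_real_derivative z' u + (q - \<beta>) * d u) (at u)"
        unfolding \<Phi>_def by (rule derivative_eq_intros z[OF uA] H[OF uA] refl)+ simp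
      moreover have "d u * (\<beta> - z u) \<le> d u * (\<beta> - q)"
        using d[OF uA] zu by (intro mult_left_mono) auto
      then have "z' u + (q - \<beta>) * d u \<le> 0"
        using decay[OF uA] zu q by (simp add: algebra_simps)
      ultimately show "\<exists>y. (\<Phi> has_real_derivative y) (at u) \<and> y \<le> 0"
        by blast
    qed
    then show ?thesis
      by (simp add: \<Phi>_def algebra_simps)
  qed
  have cont: "continuous_on {A..t} z"
    using z by (intro continuous_at_imp_continuous_on) (blast intro: DERIV_isCont)
  let ?B = "{u \<in> {A..t}. z u \<le> q}"
  show False
  proof (cases "?B = {}")
    case True
    then have "q \<le> z u" if "u \<in> {A..t}" for u
      using that by force
    then show False
      using decrease[of A] At start long above by auto
  next
    case False
    have "compact ?B"
      using continuous_on_closed_Collect_le[OF cont continuous_on_const, of q]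
      by (auto simp: compact_eq_bounded_closed intro: bounded_subset[OF bounded_closed_interval[of A t]])
    then obtain a where a: "a \<in> ?B" "\<And>u. u \<in> ?B \<Longrightarrow> u \<le> a"
      using compact_attains_sup[OF _ False] by meson
    obtain x where x: "a \<le> x" "x \<le> t" "z x = q"
      using a above IVT'[of z a q t] continuous_on_subset[OF cont] by auto
    then have "x \<le> a"
      using a by simp
    then have "z a = q"
      using x by simp
    moreover have "q \<le> z u" if "u \<in> {a<..t}" for u
      using a(2)[of u] a(1) that by force
    ultimately have "z t + (q - \<beta>) * (H t - H a) \<le> q"
      using decrease[of a] a by auto
    moreover have "H a \<le> H t"
    proof (rule DERIV_nonneg_imp_nondecreasing[of a t H])
      show "a \<le> t"
        using a by simp
      fix u assume "a \<le> u" "u \<le> t"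
      then have "u \<in> {A..t}"
        using a by simp
      then show "\<exists>y. (H has_real_derivative y) (at u) \<and> 0 \<le> y"
        using H d by (intro exI[of _ "d u"]) (simp add: less_imp_le)
    qed
    ultimately show False
      using above q by (smt (verit) mult_nonneg_nonneg)
  qed
qed

section \<open>Weights and the phase space\<close>

lemma phase_weight_ge_1: "phase_weight g \<Longrightarrow> s \<le> 0 \<Longrightarrow> 1 \<le> g s"
  by (simp add: phase_weight_def)

lemma phase_weight_antimono: "phase_weight g \<Longrightarrow> s \<le> s' \<Longrightarrow> s' \<le> 0 \<Longrightarrow> g s' \<le> g s"
  using monotone_onD[of "{..0}" "(\<le>)" "(\<ge>)" g s s'] by (simp add: phase_weight_def)

lemma infnorm_le_components:
  fixes y :: "real ^ 'n"
  assumes "\<And>i. \<bar>y $ i\<bar> \<le> b"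
  shows "infnorm y \<le> b"
  unfolding infnorm_cart using assms by (intro cSup_least) auto

lemma phase_space_bdd:
  assumes g: "phase_weight g" and \<phi>: "\<phi> \<in> phase_space g"
  shows "bdd_above ((\<lambda>s. infnorm (\<phi> s) / g s) ` {..0})"
proof -
  have "\<forall>\<^sub>F s in at_bot. infnorm (\<phi> s) / g s < 1"
    using \<phi> by (auto simp: phase_space_def intro: order_tendstoD)
  then obtain K where K: "\<And>s. s \<le> K \<Longrightarrow> infnorm (\<phi> s) / g s < 1"
    unfolding eventually_at_bot_linorder by blast
  have "continuous_on {K..0} (\<lambda>s. infnorm (\<phi> s))"
    using \<phi> by (auto simp: phase_space_def intro!: continuous_on_infnorm intro: continuous_on_subset)
  then have "bounded ((\<lambda>s. infnorm (\<phi> s)) ` {K..0})"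
    by (intro compact_imp_bounded compact_continuous_image) auto
  then obtain C where C: "\<And>s. s \<in> {K..0} \<Longrightarrow> infnorm (\<phi> s) \<le> C"
    unfolding bounded_iff by (metis abs_le_D1 image_eqI real_norm_def)
  show ?thesis
  proof (rule bdd_aboveI2[where M = "max 1 C"])
    fix s :: real assume s: "s \<in> {..0}"
    show "infnorm (\<phi> s) / g s \<le> max 1 C"
    proof (cases "s \<le> K")
      case True
      then show ?thesis
        using K[of s] by auto
    next
      case False
      have "infnorm (\<phi> s) / g s \<le> infnorm (\<phi> s) / 1"
        using phase_weight_ge_1[OF g, of s] s infnorm_pos_le by (intro divide_left_mono) auto
      then show ?thesis
        using C[of s] s False by (auto intro: max.coboundedI2)
    qed
  qed
qed

lemma component_le_phase_norm:
  assumes g: "phase_weight g" and \<phi>: "\<phi> \<in> phase_space g" and s: "s \<le> 0"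
  shows "\<bar>\<phi> s $ i\<bar> \<le> phase_norm g \<phi> * g s"
proof -
  have "infnorm (\<phi> s) / g s \<le> phase_norm g \<phi>"
    unfolding phase_norm_def using s by (intro cSup_upper phase_space_bdd[OF g \<phi>]) auto
  then have "infnorm (\<phi> s) \<le> phase_norm g \<phi> * g s"
    using phase_weight_ge_1[OF g s] by (simp add: pos_divide_le_eq)
  then show ?thesis
    using component_le_infnorm_cart[of "\<phi> s" i] by simp
qed

lemma first_hitting_time:
  fixes f :: "'i :: finite \<Rightarrow> real \<Rightarrow> real"
  assumes cont: "\<And>i. continuous_on {a..b} (f i)" and start: "\<And>i. f i a < 0"
    and hit: "0 \<le> f i0 b" and ab: "a \<le> b"
  obtains t i where "a < t" "t \<le> b" "f i t = 0" "\<And>j u. u \<in> {a..t} \<Longrightarrow> f j u \<le> 0"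
proof -
  let ?Z = "\<Union>i. {t \<in> {a..b}. 0 \<le> f i t}"
  have "compact {t \<in> {a..b}. 0 \<le> f i t}" for i
    using continuous_on_closed_Collect_le[OF continuous_on_const cont, of 0 i]
    by (auto simp: compact_eq_bounded_closed intro: bounded_subset[OF bounded_closed_interval[of a b]])
  then have "compact ?Z"
    by (intro compact_UN) auto
  moreover have "?Z \<noteq> {}"
    using hit ab by auto
  ultimately obtain t where t: "t \<in> ?Z" "\<And>u. u \<in> ?Z \<Longrightarrow> t \<le> u"
    using compact_attains_inf by meson
  then obtain i where i: "0 \<le> f i t" "a \<le> t" "t \<le> b"
    by auto
  have le: "f j t \<le> 0" for j
  proof (rule ccontr)
    assume "\<not> f j t \<le> 0"
    then obtain u where u: "a \<le> u" "u \<le> t" "f j u = 0"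
      using IVT'[of "f j" a 0 t] start[of j] i continuous_on_subset[OF cont[of j], of "{a..t}"] by auto
    then have "t \<le> u"
      using i by (intro t(2)) (auto intro: exI[of _ j])
    then show False
      using u \<open>\<not> f j t \<le> 0\<close> by simp
  qed
  have "f j u \<le> 0" if "u \<in> {a..t}" for j u
  proof (cases "u = t")
    case False
    then show ?thesis
      using t(2)[of u] that i by (cases "0 \<le> f j u") auto
  qed (simp add: le)
  moreover have "t \<noteq> a"
    using i(1) start[of i] by auto
  ultimately show ?thesis
    using that[of t i] i le[of i] by fastforce
qed

section \<open>The linear system\<close>

subsection \<open>Coefficients, intrinsic clocks and drift\<close>

locale delay_system =
  fixes g :: "real \<Rightarrow> real"
    and p :: nat
    and d :: "'n::finite \<Rightarrow> 'n \<Rightarrow> nat \<Rightarrow> real \<Rightarrow> real"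
    and \<tau> :: "'n \<Rightarrow> 'n \<Rightarrow> nat \<Rightarrow> real \<Rightarrow> real"
    and \<xi> :: "'n \<Rightarrow> 'n \<Rightarrow> nat \<Rightarrow> real \<Rightarrow> real \<Rightarrow> real"
    and r \<alpha> T :: real
    and v :: "real ^ 'n"
    and e :: "real \<Rightarrow> real"
  assumes weight: "phase_weight g"
    and d_cont: "\<And>i j k. k \<in> {1..p} \<Longrightarrow> continuous_on {0..} (d i j k)"
    and \<tau>_cont: "\<And>i j k. k \<in> {1..p} \<Longrightarrow> continuous_on {0..} (\<tau> i j k)"
    and \<tau>_nonneg: "\<And>i j k t. k \<in> {1..p} \<Longrightarrow> 0 \<le> t \<Longrightarrow> 0 \<le> \<tau> i j k t"
    and \<xi>_bv: "\<And>i j k t. k \<in> {1..p} \<Longrightarrow> 0 \<le> t \<Longrightarrow> bounded_variation_on (- \<tau> i j k t) 0 (\<xi> i j k t)"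
    and \<xi>_var: "\<And>i j k t. k \<in> {1..p} \<Longrightarrow> 0 \<le> t \<Longrightarrow> total_variation (- \<tau> i j k t) 0 (\<xi> i j k t) = 1"
    and \<xi>_mono: "\<And>i k t. k \<in> {1..p} \<Longrightarrow> 0 \<le> t \<Longrightarrow> mono_on {- \<tau> i i k t..0} (\<xi> i i k t)"
    and d_nonneg: "\<And>i k t. k \<in> {1..p} \<Longrightarrow> 0 \<le> t \<Longrightarrow> 0 \<le> d i i k t"
    and d_diag_pos: "\<And>i t. 0 \<le> t \<Longrightarrow> 0 < d_diag p d i t"
    and r_pos: "0 < r"
    and \<tau>_diag: "\<And>i k t. k \<in> {1..p} \<Longrightarrow> 0 \<le> t \<Longrightarrow> \<tau> i i k t \<le> r"
    and \<alpha>: "1 < \<alpha>"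
    and r_le_T: "r \<le> T"
    and v_pos: "\<And>i. 0 < v $ i"
    and e_nonneg: "\<And>t. 0 \<le> e t"
    and e_meas: "e \<in> borel_measurable lebesgue"
    and e_locint: "\<And>a b. set_integrable lebesgue {a..b} e"
    and margin: "\<And>t. T \<le> t \<Longrightarrow> e t \<le> Min (range (\<lambda>i. (M_mat g p d \<tau> t *v v) $ i))"
    and dominance: "\<And>t i. T \<le> t \<Longrightarrow>
          (\<alpha> *\<^sub>R ((C_mat g p d \<tau> t + A_mat g p d \<tau> t) *v v)) $ i \<le> (D_mat p d t *v v) $ i"
    and e_infinite: "(\<integral>\<^sup>+ t\<in>{0..}. ennreal (e t) \<partial>lebesgue) = \<infinity>"
    and e_window: "bdd_above ((\<lambda>t. LINT u:{t - max_delay p \<tau> t..t}|lebesgue. e u) ` {T..})"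
begin

abbreviation "rhs \<equiv> system_rhs p d \<tau> \<xi>"
abbreviation "D \<equiv> d_diag p d"

definition "\<beta> = 1 / \<alpha>"

text \<open>The off-diagonal coupling into component \<open>i\<close>, relative to its decay rate, for states bounded by \<open>v\<close>.\<close>

definition "\<theta> i t = (\<Sum>j\<in>UNIV. a_hat g p d \<tau> i j t * v $ j) / (v $ i * D i t)"

text \<open>The intrinsic clock of the \<open>i\<close>-th component.\<close>

definition "H i t = integral {0..t} (D i)"

lemma \<beta>: "0 < \<beta>" "\<beta> < 1"
  using \<alpha> by (auto simp: \<beta>_def)

lemma T_pos: "0 < T"
  using r_pos r_le_T by simp

lemma diag_mat_mult: "(diag_mat f *v y) $ i = f i * y $ i"
proof -
  have "(\<Sum>j\<in>UNIV. (if i = j then f i else 0) * y $ j) = (\<Sum>j\<in>{i}. f i * y $ j)"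
    by (intro sum.mono_neutral_cong_right) auto
  then show ?thesis
    by (simp add: diag_mat_def matrix_vector_mult_def)
qed

lemma D_cont: "continuous_on {0..} (D i)"
  unfolding d_diag_def by (intro continuous_intros d_cont) auto

lemma H_diff:
  assumes "0 \<le> a" "a \<le> b"
  shows "H i b - H i a = integral {a..b} (D i)" "D i integrable_on {a..b}"
proof -
  have int: "D i integrable_on {c..b}" if "0 \<le> c" for c
    using that by (intro integrable_continuous_real continuous_on_subset[OF D_cont]) auto
  show "H i b - H i a = integral {a..b} (D i)" "D i integrable_on {a..b}"
    using Henstock_Kurzweil_Integration.integral_combine[OF assms int[OF order.refl]] int assms
    by (auto simp: H_def)
qed

lemma H_deriv:
  assumes "0 < t"
  shows "(H i has_real_derivative D i t) (at t)"
proof -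
  have "(H i has_real_derivative D i t) (at t within {0..t + 1})"
    unfolding H_def using assms
    by (intro integral_has_real_derivative continuous_on_subset[OF D_cont]) auto
  moreover have "t \<in> interior {0..t + 1}"
    using assms by simp
  ultimately show ?thesis
    by (metis at_within_interior)
qed

lemma H_strict_mono: "strict_mono_on {0..} (H i)"
proof (rule strict_mono_onI)
  fix a b :: real assume ab: "a \<in> {0..}" "b \<in> {0..}" "a < b"
  have "0 < integral {a..b} (D i)"
  proof -
    obtain c where c: "c \<in> {a..b}" "\<And>u. u \<in> {a..b} \<Longrightarrow> D i c \<le> D i u"
      using continuous_attains_inf[of "{a..b}" "D i"] ab continuous_on_subset[OF D_cont[of i], of "{a..b}"]
      by auto
    have "D i c * (b - a) = integral {a..b} (\<lambda>_. D i c)"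
      using ab by simp
    also have "\<dots> \<le> integral {a..b} (D i)"
      using ab H_diff(2)[of a b i] c by (intro integral_le) auto
    finally have "D i c * (b - a) \<le> integral {a..b} (D i)" .
    moreover have "0 < D i c * (b - a)"
      using ab c by (intro mult_pos_pos d_diag_pos) auto
    ultimately show ?thesis
      by simp
  qed
  then show "H i a < H i b"
    using H_diff(1)[of a b i] ab by simp
qed

lemma H_mono: "0 \<le> a \<Longrightarrow> a \<le> b \<Longrightarrow> H i a \<le> H i b"
  using strict_mono_onD[OF H_strict_mono, of a b i] by (cases "a = b") auto

lemma weight_cont:
  assumes "k \<in> {1..p}"
  shows "continuous_on {0..} (\<lambda>u. g (- \<tau> i j k u))"
proof -
  have "continuous_on {..0} g"
    using weight by (simp add: phase_weight_def)
  then show ?thesis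
    using assms \<tau>_nonneg by (intro continuous_on_compose2[OF _ continuous_on_minus[OF \<tau>_cont]]) auto
qed

lemma weight_ge_1: "k \<in> {1..p} \<Longrightarrow> 0 \<le> u \<Longrightarrow> 1 \<le> g (- \<tau> i j k u)"
  using \<tau>_nonneg by (intro phase_weight_ge_1[OF weight]) auto

text \<open>
  The left side is \<open>D i t\<close> times the weighted mean of the diagonal delays, measured on the clock \<open>H i\<close>.
\<close>

lemma c_hat_ge:
  assumes t: "T \<le> t"
  shows "(\<Sum>k=1..p. d i i k t * (H i t - H i (t - \<tau> i i k t))) \<le> c_hat g p d \<tau> i t"
  unfolding c_hat_def
proof (intro sum_mono mult_left_mono)
  fix k assume k: "k \<in> {1..p}"
  let ?f = "\<lambda>u. \<Sum>l=1..p. \<Sum>j\<in>UNIV. g (- \<tau> i j l u) * \<bar>d i j l u\<bar>"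
  let ?a = "t - \<tau> i i k t"
  have a: "0 \<le> ?a" "?a \<le> t"
    using \<tau>_diag[OF k, of t i] \<tau>_nonneg[OF k, of t i i] t T_pos r_le_T by auto
  have cont: "continuous_on {?a..t} ?f"
    using a by (intro continuous_intros continuous_on_subset[OF weight_cont] continuous_on_subset[OF d_cont]) auto
  have "(LINT u:{?a..t}|lebesgue. ?f u) = integral {?a..t} ?f"
    using cont by (intro set_lebesgue_integral_eq_integral absolutely_integrable_continuous_real)
  moreover have "integral {?a..t} (D i) \<le> integral {?a..t} ?f"
  proof (rule integral_le)
    fix u assume "u \<in> {?a..t}"
    then have u: "0 \<le> u"
      using a by auto
    show "D i u \<le> ?f u"
      unfolding d_diag_def
    proof (rule sum_mono)
      fix l assume l: "l \<in> {1..p}"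
      have "d i i l u \<le> g (- \<tau> i i l u) * \<bar>d i i l u\<bar>"
        using weight_ge_1[OF l u, of i i] d_nonneg[OF l u, of i] mult_right_mono[of 1 "g (- \<tau> i i l u)" "d i i l u"] by simp
      also have "\<dots> \<le> (\<Sum>j\<in>UNIV. g (- \<tau> i j l u) * \<bar>d i j l u\<bar>)"
        using weight_ge_1[OF l u, of i]
        by (intro member_le_sum[where f = "\<lambda>j. g (- \<tau> i j l u) * \<bar>d i j l u\<bar>"])
           (auto intro!: mult_nonneg_nonneg intro: order_trans[OF zero_le_one])
      finally show "d i i l u \<le> (\<Sum>j\<in>UNIV. g (- \<tau> i j l u) * \<bar>d i j l u\<bar>)" .
    qed
  qed (use H_diff(2)[OF a] integrable_continuous_real[OF cont] in auto)
  ultimately show "H i t - H i ?a \<le> (LINT u:{?a..t}|lebesgue. ?f u)"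
    using H_diff(1)[OF a] by simp
qed (use t T_pos d_nonneg in auto)

lemma c_hat_nonneg:
  assumes t: "T \<le> t"
  shows "0 \<le> c_hat g p d \<tau> i t"
proof -
  have "0 \<le> d i i k t * (H i t - H i (t - \<tau> i i k t))" if "k \<in> {1..p}" for k
    using \<tau>_diag[OF that, of t i] \<tau>_nonneg[OF that, of t i i] t T_pos r_le_T d_nonneg[OF that, of t i] H_mono[of _ t i]
    by (intro mult_nonneg_nonneg) auto
  then have "0 \<le> (\<Sum>k=1..p. d i i k t * (H i t - H i (t - \<tau> i i k t)))"
    by (rule sum_nonneg)
  then show ?thesis
    using c_hat_ge[OF t, of i] by linarith
qed

lemma a_hat_nonneg: "0 \<le> t \<Longrightarrow> 0 \<le> a_hat g p d \<tau> i j t"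
  unfolding a_hat_def using weight_ge_1
  by (auto intro!: sum_nonneg mult_nonneg_nonneg intro: order_trans[OF zero_le_one])

lemma \<theta>_eq: "0 \<le> t \<Longrightarrow> (\<Sum>j\<in>UNIV. a_hat g p d \<tau> i j t * v $ j) = \<theta> i t * D i t * v $ i"
  using v_pos[of i] d_diag_pos[of t i] by (simp add: \<theta>_def)

lemma \<theta>_nonneg: "0 \<le> t \<Longrightarrow> 0 \<le> \<theta> i t"
  unfolding \<theta>_def using v_pos d_diag_pos[of t i] a_hat_nonneg
  by (intro divide_nonneg_nonneg sum_nonneg mult_nonneg_nonneg) (auto simp: less_imp_le)

text \<open>In this form, hypothesis (ii) bounds the mean delay of component \<open>i\<close> plus its coupling strength by \<open>\<beta>\<close>.\<close>

lemma dominance_scalar: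
  assumes t: "T \<le> t"
  shows "c_hat g p d \<tau> i t \<le> (\<beta> - \<theta> i t) * D i t"
proof -
  have t0: "0 \<le> t"
    using t T_pos by simp
  have "\<alpha> * (c_hat g p d \<tau> i t * v $ i + \<theta> i t * D i t * v $ i) \<le> D i t * v $ i"
    using dominance[OF t, of i] \<theta>_eq[OF t0, of i]
    by (simp add: C_mat_def A_mat_def D_mat_def matrix_vector_mult_add_rdistrib diag_mat_mult)
       (simp add: matrix_vector_mult_def)
  then have "(\<alpha> * (c_hat g p d \<tau> i t + \<theta> i t * D i t)) * v $ i \<le> D i t * v $ i"
    by (simp add: algebra_simps)
  then have "\<alpha> * (c_hat g p d \<tau> i t + \<theta> i t * D i t) \<le> D i t"
    using v_pos[of i] by simp
  then have "c_hat g p d \<tau> i t + \<theta> i t * D i t \<le> D i t / \<alpha>"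
    using \<alpha> by (simp add: pos_le_divide_eq mult.commute)
  then show ?thesis
    by (simp add: \<beta>_def left_diff_distrib)
qed

lemma \<theta>_le_\<beta>: "T \<le> t \<Longrightarrow> \<theta> i t \<le> \<beta>"
  using dominance_scalar[of t i] c_hat_nonneg[of t i] d_diag_pos[of t i] T_pos
  by (smt (verit) mult_neg_pos)

text \<open>Hypothesis (i) makes the intrinsic clocks run at least as fast as a multiple of the integral of \<open>e\<close>.\<close>

lemma e_le_D:
  assumes t: "T \<le> t"
  shows "e t \<le> D i t * v $ i"
proof -
  have t0: "0 \<le> t"
    using t T_pos by simp
  have "e t \<le> (M_mat g p d \<tau> t *v v) $ i"
    using margin[OF t] by (rule order_trans) auto
  also have "\<dots> = D i t * v $ i - c_hat g p d \<tau> i t * v $ i - \<theta> i t * D i t * v $ i"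
    using \<theta>_eq[OF t0, of i]
    by (simp add: M_mat_def C_mat_def D_mat_def A_mat_def matrix_vector_mult_diff_rdistrib diag_mat_mult)
       (simp add: matrix_vector_mult_def)
  also have "\<dots> \<le> D i t * v $ i"
    using c_hat_nonneg[OF t, of i] \<theta>_nonneg[OF t0, of i] d_diag_pos[OF t0, of i] v_pos[of i]
    by (smt (verit) mult_nonneg_nonneg)
  finally show ?thesis .
qed

lemma e_integrable: "e integrable_on {a..b}" and LINT_e: "(LINT u:{a..b}|lebesgue. e u) = integral {a..b} e"
  using set_lebesgue_integral_eq_integral[OF e_locint] by auto

lemma integral_e_mono: "a \<le> a' \<Longrightarrow> b' \<le> b \<Longrightarrow> integral {a'..b'} e \<le> integral {a..b} e"
  by (intro integral_subset_le e_integrable) (auto simp: e_nonneg)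

lemma integral_e_unbounded:
  assumes a: "0 \<le> a"
  shows "\<exists>b\<ge>a. C < integral {a..b} e"
proof (rule ccontr)
  assume "\<not> ?thesis"
  then have C: "integral {a..b} e \<le> C" if "a \<le> b" for b
    using that by force
  let ?f = "\<lambda>n t. ennreal (e t) * indicator {0..real n} t"
  have bound: "(\<integral>\<^sup>+t. ?f n t \<partial>lebesgue) \<le> ennreal (integral {0..a} e + C)" for n
  proof -
    define b where "b = max a (real n)"
    have "(\<integral>\<^sup>+t. ?f n t \<partial>lebesgue) = (\<integral>\<^sup>+t. ennreal (indicat_real {0..real n} t *\<^sub>R e t) \<partial>lebesgue)"
      by (intro nn_integral_cong) (auto simp: indicator_def)
    also have "\<dots> = ennreal (LINT t:{0..real n}|lebesgue. e t)"
      using e_locint[of 0 "real n"] unfolding set_integrable_def set_lebesgue_integral_def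
      by (intro nn_integral_eq_integral) (auto simp: e_nonneg)
    also have "\<dots> = ennreal (integral {0..real n} e)"
      by (simp add: LINT_e)
    also have "integral {0..real n} e \<le> integral {0..b} e"
      by (intro integral_e_mono) (auto simp: b_def)
    also have "integral {0..b} e = integral {0..a} e + integral {a..b} e"
      using a Henstock_Kurzweil_Integration.integral_combine[OF a _ e_integrable, of b] by (simp add: b_def)
    also have "\<dots> \<le> integral {0..a} e + C"
      using C[of b] by (simp add: b_def)
    finally show ?thesis
      by (simp add: ennreal_leI)
  qed
  have "(\<integral>\<^sup>+t\<in>{0..}. ennreal (e t) \<partial>lebesgue) = (\<integral>\<^sup>+t. (SUP n. ?f n t) \<partial>lebesgue)"
  proof (intro nn_integral_cong antisym SUP_least)
    fix t :: real
    obtain n where "t \<le> real n"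
      using real_arch_simple by blast
    then have "ennreal (e t) * indicator {0..} t \<le> ?f n t"
      by (auto simp: indicator_def)
    then show "ennreal (e t) * indicator {0..} t \<le> (SUP n. ?f n t)"
      by (rule order_trans) (intro SUP_upper, simp)
    show "?f n t \<le> ennreal (e t) * indicator {0..} t" for n
      by (auto simp: indicator_def)
  qed
  also have "\<dots> = (SUP n. \<integral>\<^sup>+t. ?f n t \<partial>lebesgue)"
  proof (rule nn_integral_monotone_convergence_SUP)
    show "incseq ?f"
      by (auto simp: incseq_def le_fun_def indicator_def)
    show "?f n \<in> borel_measurable lebesgue" for n
      using e_meas by (intro borel_measurable_times_ennreal borel_measurable_indicator measurable_compose[OF _ measurable_ennreal]) auto
  qed
  also have "\<dots> \<le> ennreal (integral {0..a} e + C)"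
    by (intro SUP_least bound)
  finally show False
    by (simp add: e_infinite top_unique)
qed

lemma H_at_top: "filterlim (H i) at_top at_top"
  unfolding filterlim_at_top
proof
  fix Z
  obtain b where b: "T \<le> b" "(Z - H i T) * v $ i < integral {T..b} e"
    using integral_e_unbounded[of T] T_pos by auto
  have "integral {T..b} e \<le> integral {T..b} (\<lambda>t. D i t * v $ i)"
    using H_diff(2)[of T b i] T_pos b
    by (intro integral_le e_integrable integrable_on_mult_left) (auto intro: e_le_D)
  also have "\<dots> = (H i b - H i T) * v $ i"
    using H_diff[of T b i] T_pos b by simp
  finally have "(Z - H i T) * v $ i < (H i b - H i T) * v $ i"
    using b by simp
  then have Z: "Z \<le> H i b"
    using v_pos[of i] by simp
  show "\<forall>\<^sub>F t in at_top. Z \<le> H i t"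
    using eventually_ge_at_top[of b]
  proof eventually_elim
    case (elim t)
    then show ?case
      using H_mono[of b t i] Z T_pos b by simp
  qed
qed

text \<open>
  A history that reached back to a fixed time at arbitrarily late times would collect more and more
  of the infinite integral of \<open>e\<close>.
\<close>

lemma delayed_time_at_top:
  "\<forall>\<^sub>F t in at_top. \<forall>i j. \<forall>k\<in>{1..p}. K \<le> t - \<tau> i j k t"
proof -
  obtain E where E: "\<And>t. T \<le> t \<Longrightarrow> integral {t - max_delay p \<tau> t..t} e \<le> E"
    using e_window by (auto simp: bdd_above_def LINT_e)
  obtain b where b: "max K 0 \<le> b" "E < integral {max K 0..b} e"
    using integral_e_unbounded[of "max K 0" E] by auto
  show ?thesis
    using eventually_ge_at_top[of "max b T"]
  proof eventually_elim
    case (elim t)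
    have "K \<le> t - max_delay p \<tau> t"
    proof (rule ccontr)
      assume "\<not> ?thesis"
      then have "integral {max K 0..b} e \<le> integral {t - max_delay p \<tau> t..t} e"
        using elim by (intro integral_e_mono) auto
      then show False
        using E[of t] b elim by auto
    qed
    moreover have "\<tau> i j k t \<le> max_delay p \<tau> t" if "k \<in> {1..p}" for i j k
    proof -
      have "{\<tau> i j k t | i j k. k \<in> {1..p}} = (\<lambda>(i, j, k). \<tau> i j k t) ` (UNIV \<times> UNIV \<times> {1..p})"
        by force
      then have "finite {\<tau> i j k t | i j k. k \<in> {1..p}}"
        by simp
      then show ?thesis
        unfolding max_delay_def using that by (intro Max_ge) auto
    qed
    ultimately show ?case
      by (meson diff_left_mono order_trans)
  qed
qed

text \<open>
  A solution is a single function on the whole line, so it can be restarted at any later initial time;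
  initial times are at least \<open>T\<close>, where the hypotheses on the coefficients are in force.
\<close>

definition solution_from :: "real \<Rightarrow> (real \<Rightarrow> real ^ 'n) \<Rightarrow> bool" where
  "solution_from \<sigma> x \<longleftrightarrow> T \<le> \<sigma> \<and> continuous_on UNIV x \<and>
     (\<forall>t\<ge>\<sigma>. (x has_vector_derivative rhs t (history x t)) (at t within {\<sigma>..}))"

lemma solution_deriv:
  assumes x: "solution_from \<sigma> x" and t: "\<sigma> < t"
  shows "((\<lambda>t. x t $ i) has_real_derivative rhs t (history x t) $ i) (at t)"
proof -
  have "(x has_vector_derivative rhs t (history x t)) (at t within {\<sigma>..})"
    using x t by (auto simp: solution_from_def)
  moreover have "t \<in> interior {\<sigma>..}"
    using t by simp
  ultimately have "(x has_vector_derivative rhs t (history x t)) (at t)"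
    by (metis at_within_interior)
  then show ?thesis
    unfolding has_real_derivative_iff_has_vector_derivative
    by (rule bounded_linear.has_vector_derivative[OF bounded_linear_vec_nth])
qed

lemma solution_component_cont: "solution_from \<sigma> x \<Longrightarrow> continuous_on S (\<lambda>t. x t $ i)"
  unfolding solution_from_def by (auto intro!: continuous_intros intro: continuous_on_subset)

lemma history_component_cont:
  assumes "solution_from \<sigma> x"
  shows "continuous_on S (\<lambda>s. history x t s $ i)"
  unfolding history_def
  by (rule continuous_on_compose2[OF solution_component_cont[OF assms, of UNIV]]) (auto intro!: continuous_intros)

lemma history_integral_abs_le:
  assumes x: "solution_from \<sigma> x" and k: "k \<in> {1..p}" and t: "0 \<le> t"
    and bound: "\<And>s. s \<in> {- \<tau> i j k t..0} \<Longrightarrow> \<bar>x (t + s) $ j\<bar> \<le> b"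
  shows "\<bar>RS_integral (- \<tau> i j k t) 0 (\<lambda>s. history x t s $ j) (\<xi> i j k t)\<bar> \<le> b"
proof -
  have "0 \<le> b"
    using bound[of 0] \<tau>_nonneg[OF k t] by (auto intro: order_trans[OF abs_ge_zero])
  then have "\<bar>RS_integral (- \<tau> i j k t) 0 (\<lambda>s. history x t s $ j) (\<xi> i j k t)\<bar>
      \<le> b * total_variation (- \<tau> i j k t) 0 (\<xi> i j k t)"
    using bound by (intro RS_integral_abs_le history_component_cont[OF x] \<xi>_bv k t) (auto simp: history_def)
  then show ?thesis
    using \<xi>_var[OF k t] by simp
qed

lemma rhs_component:
  "rhs t (history x t) $ i =
    - (\<Sum>j\<in>UNIV. \<Sum>k=1..p. d i j k t * RS_integral (- \<tau> i j k t) 0 (\<lambda>s. history x t s $ j) (\<xi> i j k t))"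
  unfolding system_rhs_def by (rule vec_lambda_beta)

lemma rhs_split_diagonal:
  fixes t :: real and x i
  defines "I \<equiv> \<lambda>j k. RS_integral (- \<tau> i j k t) 0 (\<lambda>s. history x t s $ j) (\<xi> i j k t)"
  shows "rhs t (history x t) $ i =
    - (\<Sum>k=1..p. d i i k t * I i k) - (\<Sum>j\<in>UNIV - {i}. \<Sum>k=1..p. d i j k t * I j k)"
proof -
  have "(\<Sum>j\<in>UNIV. \<Sum>k=1..p. d i j k t * I j k) =
      (\<Sum>k=1..p. d i i k t * I i k) + (\<Sum>j\<in>UNIV - {i}. \<Sum>k=1..p. d i j k t * I j k)"
    by (intro sum.remove) auto
  then show ?thesis
    unfolding rhs_component I_def by linarith
qed

text \<open>
  The factor \<open>g (- \<tau> i j k t)\<close> in the bound admits values from the initial history, where only a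
  weighted bound is known.
\<close>

lemma coupling_abs_le:
  assumes x: "solution_from \<sigma> x" and t: "0 \<le> t"
    and bound: "\<And>j k s. k \<in> {1..p} \<Longrightarrow> s \<in> {- \<tau> i j k t..0} \<Longrightarrow>
      \<bar>x (t + s) $ j\<bar> \<le> v $ j * B * g (- \<tau> i j k t)"
  shows "\<bar>\<Sum>j\<in>UNIV - {i}. \<Sum>k=1..p. d i j k t *
      RS_integral (- \<tau> i j k t) 0 (\<lambda>s. history x t s $ j) (\<xi> i j k t)\<bar> \<le> \<theta> i t * D i t * (v $ i * B)"
    (is "\<bar>\<Sum>j\<in>_. \<Sum>k=1..p. d i j k t * ?I j k\<bar> \<le> _")
proof -
  have "\<bar>\<Sum>j\<in>UNIV - {i}. \<Sum>k=1..p. d i j k t * ?I j k\<bar>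
      \<le> (\<Sum>j\<in>UNIV - {i}. \<Sum>k=1..p. \<bar>d i j k t * ?I j k\<bar>)"
    by (intro order_trans[OF sum_abs] sum_mono) simp
  also have "\<dots> \<le> (\<Sum>j\<in>UNIV - {i}. \<Sum>k=1..p. \<bar>d i j k t\<bar> * (v $ j * B * g (- \<tau> i j k t)))"
    unfolding abs_mult using t
    by (intro sum_mono mult_left_mono history_integral_abs_le[OF x] bound) auto
  also have "\<dots> = (\<Sum>j\<in>UNIV - {i}. a_hat g p d \<tau> i j t * v $ j) * B"
    unfolding sum_distrib_right
    by (intro sum.cong refl) (auto simp: a_hat_def sum_distrib_left sum_distrib_right mult_ac)
  also have "(\<Sum>j\<in>UNIV - {i}. a_hat g p d \<tau> i j t * v $ j) = (\<Sum>j\<in>UNIV. a_hat g p d \<tau> i j t * v $ j)"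
    by (intro sum.mono_neutral_left) (auto simp: a_hat_def)
  finally show ?thesis
    using \<theta>_eq[OF t, of i] by (simp add: mult.assoc)
qed

text \<open>
  A component normalised by \<open>v $ i * B\<close> satisfies the hypothesis \<open>drift\<close> of
  \<open>averaged_delay_decay\<close>. The factor \<open>s = \<plusminus> 1\<close> treats upper and lower bounds at once.
\<close>

lemma component_drift:
  assumes x: "solution_from \<sigma> x" and t: "T \<le> t" and B: "0 < B" and s: "s = 1 \<or> s = - 1"
    and bound: "\<And>j k s. k \<in> {1..p} \<Longrightarrow> s \<in> {- \<tau> i j k t..0} \<Longrightarrow>
      \<bar>x (t + s) $ j\<bar> \<le> v $ j * B * g (- \<tau> i j k t)"
    and line: "\<And>w. w \<in> {t - r..t} \<Longrightarrow> c - L * (H i t - H i w) \<le> s * x w $ i / (v $ i * B)"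
    and L: "0 \<le> L"
  shows "s * rhs t (history x t) $ i / (v $ i * B) \<le> D i t * (\<theta> i t - c + L * (\<beta> - \<theta> i t))"
proof -
  define V where "V = v $ i * B"
  have V: "0 < V"
    using v_pos B by (simp add: V_def)
  have t0: "0 \<le> t"
    using t T_pos by simp
  let ?I = "\<lambda>j k. RS_integral (- \<tau> i j k t) 0 (\<lambda>s. history x t s $ j) (\<xi> i j k t)"
  let ?w = "\<lambda>k. H i t - H i (t - \<tau> i i k t)"
  have diag: "V * (c - L * ?w k) \<le> s * ?I i k" if k: "k \<in> {1..p}" for k
  proof -
    have \<tau>: "0 \<le> \<tau> i i k t" "\<tau> i i k t \<le> r"
      using \<tau>_nonneg[OF k t0] \<tau>_diag[OF k t0] by auto
    \<comment> \<open>As \<open>H i\<close> increases, the line is lowest at the far end of the delay interval.\<close>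
    have lower: "V * (c - L * ?w k) \<le> s * history x t u $ i" if u: "u \<in> {- \<tau> i i k t..0}" for u
    proof -
      have "H i (t - \<tau> i i k t) \<le> H i (t + u)"
        using u \<tau> t r_le_T by (intro H_mono) auto
      then have "c - L * ?w k \<le> c - L * (H i t - H i (t + u))"
        using L by (simp add: mult_left_mono)
      also have "\<dots> \<le> s * x (t + u) $ i / V"
        unfolding V_def using u \<tau> by (intro line) auto
      finally show ?thesis
        using V by (simp add: pos_le_divide_eq mult.commute history_def)
    qed
    note RS = RS_integral_mono_on_bounds[OF history_component_cont[OF x, where i = i] \<xi>_bv[OF k t0] _ \<xi>_mono[OF k t0] \<xi>_var[OF k t0]]
    from s show ?thesis
    proof
      assume "s = 1"
      moreover have "V * (c - L * ?w k) \<le> ?I i k"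
        using lower \<tau> \<open>s = 1\<close> by (intro RS(1)) auto
      ultimately show ?thesis
        by simp
    next
      assume "s = - 1"
      moreover have "?I i k \<le> - (V * (c - L * ?w k))"
      proof (rule RS(2))
        fix u assume "u \<in> {- \<tau> i i k t..0}"
        then show "history x t u $ i \<le> - (V * (c - L * ?w k))"
          using lower[of u] \<open>s = - 1\<close> by simp
      qed (use \<tau> in simp)
      ultimately show ?thesis
        by simp
    qed
  qed
  have "(\<Sum>k=1..p. d i i k t * (V * (c - L * ?w k))) \<le> (\<Sum>k=1..p. d i i k t * (s * ?I i k))"
    using d_nonneg t0 by (intro sum_mono mult_left_mono diag) auto
  also have "(\<Sum>k=1..p. d i i k t * (V * (c - L * ?w k))) = V * (c * D i t - L * (\<Sum>k=1..p. d i i k t * ?w k))"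
    by (simp add: d_diag_def sum_distrib_left sum_subtractf sum.distrib algebra_simps)
  also have "(\<Sum>k=1..p. d i i k t * (s * ?I i k)) = s * (\<Sum>k=1..p. d i i k t * ?I i k)"
    by (simp add: sum_distrib_left mult_ac)
  finally have "V * (c * D i t - L * (\<Sum>k=1..p. d i i k t * ?w k)) \<le> s * (\<Sum>k=1..p. d i i k t * ?I i k)" .
  moreover have "V * (c * D i t - L * ((\<beta> - \<theta> i t) * D i t)) \<le> V * (c * D i t - L * (\<Sum>k=1..p. d i i k t * ?w k))"
    using V L order_trans[OF c_hat_ge[OF t, of i] dominance_scalar[OF t, of i]]
    by (intro mult_left_mono diff_left_mono) auto
  moreover have "- s * (\<Sum>j\<in>UNIV - {i}. \<Sum>k=1..p. d i j k t * ?I j k) \<le> \<theta> i t * D i t * V"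
  proof -
    have "\<bar>\<Sum>j\<in>UNIV - {i}. \<Sum>k=1..p. d i j k t * ?I j k\<bar> \<le> \<theta> i t * D i t * V"
      unfolding V_def by (rule coupling_abs_le[OF x t0 bound])
    with s show ?thesis
      by (elim disjE) (simp_all only: abs_le_iff minus_minus mult_1 mult_minus1)
  qed
  ultimately have "s * rhs t (history x t) $ i \<le> V * (D i t * (\<theta> i t - c + L * (\<beta> - \<theta> i t)))"
    unfolding rhs_split_diagonal by (simp add: algebra_simps)
  then show ?thesis
    using V by (simp add: V_def pos_divide_le_eq mult.commute)
qed

text \<open>
  This is \<open>averaged_delay_decay\<close> for a normalised component: \<open>bound\<close> controls the coupling, \<open>bound_i\<close>
  the component's own past.
\<close>

lemma component_decay:
  assumes x: "solution_from \<sigma> x" and B: "0 < B" and s: "s = 1 \<or> s = - 1"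
    and A: "\<sigma> < A" "A \<le> t" "2 \<le> H i t - H i A"
    and bound: "\<And>u j k s. u \<in> {A..t} \<Longrightarrow> k \<in> {1..p} \<Longrightarrow> s \<in> {- \<tau> i j k u..0} \<Longrightarrow>
      \<bar>x (u + s) $ j\<bar> \<le> v $ j * B * g (- \<tau> i j k u)"
    and bound_i: "\<And>u. u \<in> {A - r..t} \<Longrightarrow> \<bar>x u $ i\<bar> \<le> v $ i * B"
    and above: "\<beta> < s * x t $ i / (v $ i * B)"
  shows "s * rhs t (history x t) $ i / (v $ i * B) \<le> D i t * (\<beta> - s * x t $ i / (v $ i * B))"
proof -
  have T: "T < A"
    using A x by (simp add: solution_from_def)
  have V: "0 < v $ i * B"
    using v_pos B by simp
  have normalised: "\<bar>s * x u $ i / (v $ i * B)\<bar> \<le> 1" if "u \<in> {A - r..t}" for u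
    unfolding abs_divide abs_of_pos[OF V] pos_divide_le_eq[OF V]
    using bound_i[OF that] s by (auto simp: abs_mult)
  show ?thesis
  proof (rule averaged_delay_decay[where H = "H i" and \<theta> = "\<theta> i" and A = A and r = r
        and d = "D i" and z = "\<lambda>u. s * x u $ i / (v $ i * B)"
        and z' = "\<lambda>u. s * rhs u (history x u) $ i / (v $ i * B)"])
    show "strict_mono_on {A - r..t} (H i)"
      using T r_le_T by (intro monotone_on_subset[OF H_strict_mono]) auto
    fix u assume u: "u \<in> {A..t}"
    show "\<theta> i u \<le> \<beta>" "0 < D i u" "(H i has_real_derivative D i u) (at u)"
      using u T T_pos by (auto intro!: \<theta>_le_\<beta> d_diag_pos H_deriv)
    show "((\<lambda>u. s * x u $ i / (v $ i * B)) has_real_derivative s * rhs u (history x u) $ i / (v $ i * B)) (at u)"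
      using u A by (intro DERIV_cdivide DERIV_cmult solution_deriv[OF x]) auto
    show "s * rhs u (history x u) $ i / (v $ i * B) \<le> D i u * (\<theta> i u - c + L * (\<beta> - \<theta> i u))"
      if "0 \<le> L" "\<And>w. w \<in> {u - r..u} \<Longrightarrow> c - L * (H i u - H i w) \<le> s * x w $ i / (v $ i * B)" for c L
      using u T by (intro component_drift[OF x _ B s bound[OF u] that(2,1)]) auto
  qed (use \<beta> r_pos A above normalised[THEN abs_le_D1, of t] normalised[THEN abs_le_D2] in \<open>auto simp: minus_le_iff\<close>)
qed

subsection \<open>Boundedness and decay of solutions\<close>

text \<open>
  At the first time at which some component reached its bound, \<open>component_decay\<close> would make that
  component strictly decrease in modulus, although it was smaller before. By the time \<open>S\<close>, the two
  units of intrinsic time that \<open>component_decay\<close> asks for have passed since \<open>\<sigma> + r\<close>, the time from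
  which on the diagonal delays reach back to \<open>\<sigma>\<close> at most.
\<close>

lemma solution_stays_bounded:
  assumes x: "solution_from \<sigma> x" and B: "0 < B"
    and S: "\<sigma> + r \<le> S" "\<And>i. 2 \<le> H i S - H i (\<sigma> + r)"
    and past: "\<And>w j. w \<le> \<sigma> \<Longrightarrow> \<bar>x w $ j\<bar> \<le> v $ j * B * g (w - \<sigma>)"
    and start: "\<And>w j. w \<in> {\<sigma>..S} \<Longrightarrow> \<bar>x w $ j\<bar> < v $ j * B"
    and t: "\<sigma> \<le> t"
  shows "\<bar>x t $ i\<bar> \<le> v $ i * B"
proof (rule ccontr)
  assume exceeds: "\<not> ?thesis"
  let ?f = "\<lambda>j u. \<bar>x u $ j\<bar> - v $ j * B"
  have \<sigma>: "T \<le> \<sigma>"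
    using x by (simp add: solution_from_def)
  have St: "S \<le> t"
    using exceeds start[of t i] t by force
  have cont: "continuous_on {S..t} (?f j)" for j
    by (intro continuous_intros solution_component_cont[OF x])
  have neg_S: "?f j S < 0" for j
    using start[of S j] S r_pos by simp
  have hit: "0 \<le> ?f i t"
    using exceeds by simp
  obtain t0 i0 where t0: "S < t0" "?f i0 t0 = 0" and before: "\<And>j u. u \<in> {S..t0} \<Longrightarrow> ?f j u \<le> 0"
    by (rule first_hitting_time[of S t ?f, OF cont neg_S hit St]) blast
  have bound: "\<bar>x u $ j\<bar> \<le> v $ j * B" if "u \<in> {\<sigma>..t0}" for u j
    using before[of u j] start[of u j] that by (cases "u \<le> S") auto
  define s where "s = sgn (x t0 $ i0)"
  have V: "0 < v $ i0 * B"
    using v_pos B by simp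
  then have s: "s = 1 \<or> s = - 1" and at_t0: "s * x t0 $ i0 = v $ i0 * B"
    using t0(2) by (auto simp: s_def sgn_if split: if_splits)
  let ?z = "\<lambda>u. s * x u $ i0 / (v $ i0 * B)"
  have z_t0: "?z t0 = 1"
    unfolding at_t0 by (rule divide_self[OF less_imp_neq[OF V, symmetric]])
  have "s * rhs t0 (history x t0) $ i0 / (v $ i0 * B) \<le> D i0 t0 * (\<beta> - ?z t0)"
  proof (rule component_decay[OF x B s])
    show "\<sigma> < \<sigma> + r" "\<sigma> + r \<le> t0"
      using r_pos S t0 by auto
    show "2 \<le> H i0 t0 - H i0 (\<sigma> + r)"
      using S(2)[of i0] H_mono[of S t0 i0] S(1) t0(1) \<sigma> T_pos r_pos by simp
    show "\<beta> < ?z t0"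
      unfolding z_t0 by (rule \<beta>(2))
    show "\<bar>x u $ i0\<bar> \<le> v $ i0 * B" if "u \<in> {\<sigma> + r - r..t0}" for u
      using bound that by simp
    fix u j k s' assume u: "u \<in> {\<sigma> + r..t0}" and k: "k \<in> {1..p}" and s': "s' \<in> {- \<tau> i0 j k u..0}"
    have u0: "0 \<le> u"
      using u \<sigma> T_pos r_pos by auto
    have vB: "0 \<le> v $ j * B"
      using v_pos[of j] B by simp
    show "\<bar>x (u + s') $ j\<bar> \<le> v $ j * B * g (- \<tau> i0 j k u)"
    proof (cases "\<sigma> \<le> u + s'")
      case True
      then have "\<bar>x (u + s') $ j\<bar> \<le> v $ j * B * 1"
        using bound[of "u + s'" j] u s' by simp
      also have "\<dots> \<le> v $ j * B * g (- \<tau> i0 j k u)"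
        using weight_ge_1[OF k u0] vB by (intro mult_left_mono) auto
      finally show ?thesis .
    next
      case False
      then have "\<bar>x (u + s') $ j\<bar> \<le> v $ j * B * g (u + s' - \<sigma>)"
        by (intro past) simp
      also have "\<dots> \<le> v $ j * B * g (- \<tau> i0 j k u)"
        using u s' False r_pos vB by (intro mult_left_mono phase_weight_antimono[OF weight]) auto
      finally show ?thesis .
    qed
  qed
  also have "\<dots> < 0"
    unfolding z_t0 using \<beta> d_diag_pos[of t0 i0] t0(1) S(1) \<sigma> T_pos r_pos by (intro mult_pos_neg) auto
  finally have neg: "s * rhs t0 (history x t0) $ i0 / (v $ i0 * B) < 0" .
  have deriv: "(?z has_real_derivative s * rhs t0 (history x t0) $ i0 / (v $ i0 * B)) (at t0)"
    using t0(1) S(1) r_pos by (intro DERIV_cdivide DERIV_cmult solution_deriv[OF x]) auto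
  obtain h where h: "0 < h" "\<And>h'. 0 < h' \<Longrightarrow> h' < h \<Longrightarrow> ?z t0 < ?z (t0 - h')"
    using DERIV_neg_dec_left[OF deriv neg] by auto
  define h' where "h' = min (h / 2) (t0 - S)"
  have "?z t0 < ?z (t0 - h')"
    using h t0(1) by (intro h(2)) (auto simp: h'_def)
  moreover have "?z (t0 - h') \<le> 1"
  proof -
    have "\<bar>x (t0 - h') $ i0\<bar> \<le> v $ i0 * B"
      using h(1) t0(1) S(1) r_pos by (intro bound) (auto simp: h'_def)
    then show ?thesis
      using s V by (auto simp: pos_divide_le_eq)
  qed
  ultimately show False
    using z_t0 by simp
qed

text \<open>
  Eventually all delayed arguments lie beyond the time from which the bound \<open>B\<close> holds. Two units of
  intrinsic time later \<open>component_decay\<close> is available at every time, and each normalised component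
  relaxes below the level \<open>(1 + \<beta>) / 2\<close>
  that lies halfway between \<open>\<beta>\<close> and \<open>1\<close>.
\<close>

lemma eventual_bound_improves:
  assumes x: "solution_from \<sigma> x" and B: "0 < B"
    and bound: "\<forall>\<^sub>F t in at_top. \<forall>i. \<bar>x t $ i\<bar> \<le> v $ i * B"
  shows "\<forall>\<^sub>F t in at_top. \<forall>i. \<bar>x t $ i\<bar> \<le> v $ i * ((1 + \<beta>) / 2 * B)"
proof -
  have \<sigma>: "T \<le> \<sigma>"
    using x by (simp add: solution_from_def)
  obtain t0 where t0: "\<And>t i. t0 \<le> t \<Longrightarrow> \<bar>x t $ i\<bar> \<le> v $ i * B"
    using bound unfolding eventually_at_top_linorder by blast
  obtain t1 where t1: "\<And>t i j k. t1 \<le> t \<Longrightarrow> k \<in> {1..p} \<Longrightarrow> t0 \<le> t - \<tau> i j k t"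
    using delayed_time_at_top[of t0] unfolding eventually_at_top_linorder by blast
  define A where "A = max (max (t0 + r) t1) (\<sigma> + 1)"
  have A: "t0 + r \<le> A" "t1 \<le> A" "\<sigma> < A" "0 < A"
    using \<sigma> T_pos by (auto simp: A_def)
  have delayed: "\<bar>x (u + s) $ j\<bar> \<le> v $ j * B * g (- \<tau> i j k u)"
    if "A \<le> u" "k \<in> {1..p}" "s \<in> {- \<tau> i j k u..0}" for u i j k s
  proof -
    have "\<bar>x (u + s) $ j\<bar> \<le> v $ j * B * 1"
      using t1[of u k i j] t0[of "u + s" j] that A by auto
    also have "\<dots> \<le> v $ j * B * g (- \<tau> i j k u)"
      using weight_ge_1[of k u i j] v_pos[of j] B that A by (intro mult_left_mono) auto
    finally show ?thesis .
  qed
  have "\<forall>\<^sub>F t in at_top. \<bar>x t $ i\<bar> \<le> v $ i * ((1 + \<beta>) / 2 * B)" for i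
  proof -
    have V: "0 < v $ i * B"
      using v_pos B by simp
    have H_reaches: "\<forall>\<^sub>F t in at_top. C \<le> H i t" for C
      using H_at_top[of i] by (simp add: filterlim_at_top)
    obtain A' where A': "A \<le> A'" "H i A + 2 \<le> H i A'"
      using eventually_happens[OF eventually_conj[OF eventually_ge_at_top[of A] H_reaches[of "H i A + 2"]]] by auto
    show ?thesis
      using H_reaches[of "H i A' + 1"] eventually_ge_at_top[of A']
    proof eventually_elim
      case (elim t)
      have upper: "s * x t $ i / (v $ i * B) \<le> (1 + \<beta>) / 2" if s: "s = 1 \<or> s = - 1" for s
      proof (rule relaxation_below_level[where A = A' and \<beta> = \<beta> and H = "H i" and d = "D i"
            and z = "\<lambda>u. s * x u $ i / (v $ i * B)"
            and z' = "\<lambda>u. s * rhs u (history x u) $ i / (v $ i * B)"])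
        show "\<beta> < (1 + \<beta>) / 2"
          using \<beta> by simp
        have "(1 - \<beta>) / 2 * 1 \<le> (1 - \<beta>) / 2 * (H i t - H i A')"
          using elim \<beta> by (intro mult_left_mono) auto
        then show "1 \<le> (1 + \<beta>) / 2 + ((1 + \<beta>) / 2 - \<beta>) * (H i t - H i A')"
          by (simp add: field_simps)
        show "s * x A' $ i / (v $ i * B) \<le> 1"
          using t0[of A' i] s V A A' r_pos by (auto simp: pos_divide_le_eq)
        fix u assume u: "u \<in> {A'..t}"
        show "0 < D i u" "(H i has_real_derivative D i u) (at u)"
          using u A A' by (auto intro!: d_diag_pos H_deriv)
        show "((\<lambda>u. s * x u $ i / (v $ i * B)) has_real_derivative s * rhs u (history x u) $ i / (v $ i * B)) (at u)"
          using u A A' by (intro DERIV_cdivide DERIV_cmult solution_deriv[OF x]) auto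
        assume "\<beta> < s * x u $ i / (v $ i * B)"
        then show "s * rhs u (history x u) $ i / (v $ i * B) \<le> D i u * (\<beta> - s * x u $ i / (v $ i * B))"
        proof (intro component_decay[OF x B s A(3)])
          show "2 \<le> H i u - H i A"
            using A' H_mono[of A' u i] u A by auto
          show "\<bar>x w $ i\<bar> \<le> v $ i * B" if "w \<in> {A - r..u}" for w
            using that A by (intro t0) auto
        qed (use u A' delayed in auto)
      qed (use elim in auto)
      show ?case
        using upper[of 1] upper[of "- 1"] V by (simp add: abs_le_iff field_simps)
    qed
  qed
  then show ?thesis
    by (rule eventually_all_finite)
qed

lemma eventually_bounded_tendsto_0:
  assumes x: "solution_from \<sigma> x" and B: "0 < B"
    and bound: "\<forall>\<^sub>F t in at_top. \<forall>i. \<bar>x t $ i\<bar> \<le> v $ i * B"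
  shows "(x \<longlongrightarrow> 0) at_top"
proof (rule vec_tendstoI)
  fix i
  define q where "q = (1 + \<beta>) / 2"
  have q: "0 < q" "q < 1"
    using \<beta> by (auto simp: q_def)
  have iterate: "\<forall>\<^sub>F t in at_top. \<forall>i. \<bar>x t $ i\<bar> \<le> v $ i * (q ^ n * B)" for n
  proof (induction n)
    case 0
    then show ?case
      using bound by simp
  next
    case (Suc n)
    then show ?case
      using eventual_bound_improves[OF x, of "q ^ n * B"] q B by (simp add: q_def mult.assoc)
  qed
  show "((\<lambda>t. x t $ i) \<longlongrightarrow> 0 $ i) at_top"
  proof (rule tendstoI)
    fix \<epsilon> :: real assume "0 < \<epsilon>"
    then have "0 < \<epsilon> / (v $ i * B)"
      using v_pos B by simp
    then obtain n where n: "q ^ n < \<epsilon> / (v $ i * B)"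
      using real_arch_pow_inv q by blast
    have V: "0 < v $ i * B"
      using v_pos B by simp
    have "v $ i * (q ^ n * B) < \<epsilon>"
      using n unfolding pos_less_divide_eq[OF V] by (simp add: mult_ac)
    then show "\<forall>\<^sub>F t in at_top. dist (x t $ i) (0 $ i) < \<epsilon>"
      using iterate[of n] by (auto simp: dist_real_def elim!: eventually_mono intro: le_less_trans)
  qed
qed

text \<open>
  A Gronwall estimate by comparison with \<open>2 * b * exp (\<bar>N\<bar> * (u - \<sigma>))\<close>; the factor \<open>2\<close> makes the
  inequality strict at the initial time, so that a first hitting time can be taken.
\<close>

lemma solution_growth:
  assumes \<sigma>: "T \<le> \<sigma>" and S: "\<sigma> \<le> S"
  obtains K where "0 < K"
    "\<And>x b t i. solution_from \<sigma> x \<Longrightarrow> 0 < b \<Longrightarrow>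
      (\<And>w j. w \<le> \<sigma> \<Longrightarrow> \<bar>x w $ j\<bar> \<le> b * g (w - \<sigma>)) \<Longrightarrow> t \<in> {\<sigma>..S} \<Longrightarrow> \<bar>x t $ i\<bar> < K * b"
proof -
  define F where "F i u = (\<Sum>j\<in>UNIV. \<Sum>k=1..p. \<bar>d i j k u\<bar> * g (- \<tau> i j k u))" for i u
  have "\<exists>N. \<forall>u\<in>{\<sigma>..S}. F i u \<le> N" for i
  proof -
    have "continuous_on {\<sigma>..S} (F i)"
      unfolding F_def using \<sigma> T_pos
      by (intro continuous_intros continuous_on_subset[OF weight_cont] continuous_on_subset[OF d_cont]) auto
    then show ?thesis
      using continuous_attains_sup[of "{\<sigma>..S}" "F i"] S by auto
  qed
  then obtain N' where N': "\<And>i u. u \<in> {\<sigma>..S} \<Longrightarrow> F i u \<le> N' i"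
    by metis
  define N where "N = Max (range N')"
  have N: "F i u \<le> N" if "u \<in> {\<sigma>..S}" for i u
    unfolding N_def using N'[OF that, of i] by (rule order_trans) auto
  show ?thesis
  proof (rule that[of "2 * exp (\<bar>N\<bar> * (S - \<sigma>)) "])
    fix x b t i
    assume x: "solution_from \<sigma> x" and b: "0 < b"
      and past: "\<And>w j. w \<le> \<sigma> \<Longrightarrow> \<bar>x w $ j\<bar> \<le> b * g (w - \<sigma>)" and t: "t \<in> {\<sigma>..S}"
    let ?E = "\<lambda>u. 2 * b * exp (\<bar>N\<bar> * (u - \<sigma>))"
    have at_\<sigma>: "\<bar>x \<sigma> $ j\<bar> \<le> b" for j
      using past[of \<sigma> j] weight by (simp add: phase_weight_def)
    have "\<bar>x t $ i\<bar> < ?E t"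
    proof (rule ccontr)
      assume "\<not> ?thesis"
      then have hit: "0 \<le> \<bar>x t $ i\<bar> - ?E t"
        by simp
      have cont: "continuous_on {\<sigma>..t} (\<lambda>u. \<bar>x u $ j\<bar> - ?E u)" for j
        by (intro continuous_intros solution_component_cont[OF x])
      have neg: "\<bar>x \<sigma> $ j\<bar> - ?E \<sigma> < 0" for j
        using at_\<sigma>[of j] b by simp
      have \<sigma>t: "\<sigma> \<le> t"
        using t by simp
      obtain t0 i0 where t0: "\<sigma> < t0" "t0 \<le> t" "\<bar>x t0 $ i0\<bar> - ?E t0 = 0"
        and before: "\<And>j u. u \<in> {\<sigma>..t0} \<Longrightarrow> \<bar>x u $ j\<bar> - ?E u \<le> 0"
        by (rule first_hitting_time[of \<sigma> t "\<lambda>j u. \<bar>x u $ j\<bar> - ?E u", OF cont neg hit \<sigma>t]) blast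
      define s where "s = sgn (x t0 $ i0)"
      have at_t0: "s * x t0 $ i0 = ?E t0" and s: "\<bar>s\<bar> \<le> 1"
        using t0(3) b by (auto simp: s_def sgn_if split: if_splits)
      have slope: "s * rhs u (history x u) $ i0 \<le> \<bar>N\<bar> * ?E u" if u: "\<sigma> < u" "u < t0" for u
      proof -
        have u0: "0 \<le> u"
          using u \<sigma> T_pos by simp
        have "\<bar>x (u + s') $ j\<bar> \<le> ?E u * g (- \<tau> i0 j k u)"
          if k: "k \<in> {1..p}" and s': "s' \<in> {- \<tau> i0 j k u..0}" for j k s'
        proof (cases "\<sigma> \<le> u + s'")
          case True
          then have "\<bar>x (u + s') $ j\<bar> \<le> ?E (u + s')"
            using before[of "u + s'" j] u s' by simp
          also have "\<dots> \<le> ?E u"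
            using s' b by (auto intro!: mult_left_mono)
          also have "\<dots> \<le> ?E u * g (- \<tau> i0 j k u)"
            using mult_left_mono[OF weight_ge_1[OF k u0, of i0 j], of "?E u"] b by simp
          finally show ?thesis .
        next
          case False
          then have "\<bar>x (u + s') $ j\<bar> \<le> b * g (u + s' - \<sigma>)"
            by (intro past) simp
          also have "\<dots> \<le> b * g (- \<tau> i0 j k u)"
            using u s' False b by (intro mult_left_mono phase_weight_antimono[OF weight]) auto
          also have "\<dots> \<le> ?E u * g (- \<tau> i0 j k u)"
          proof (intro mult_right_mono)
            have "1 \<le> exp (\<bar>N\<bar> * (u - \<sigma>))"
              using u by simp
            then show "b \<le> ?E u"
              using b by (smt (verit) mult_le_cancel_left1 mult.assoc)
          qed (use weight_ge_1[OF k u0, of i0 j] in simp)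
          finally show ?thesis .
        qed
        then have "\<bar>RS_integral (- \<tau> i0 j k u) 0 (\<lambda>s. history x u s $ j) (\<xi> i0 j k u)\<bar> \<le> ?E u * g (- \<tau> i0 j k u)"
          if "k \<in> {1..p}" for j k
          using that by (intro history_integral_abs_le[OF x _ u0]) auto
        then have "\<bar>rhs u (history x u) $ i0\<bar> \<le> (\<Sum>j\<in>UNIV. \<Sum>k=1..p. \<bar>d i0 j k u\<bar> * (?E u * g (- \<tau> i0 j k u)))"
          unfolding rhs_component abs_minus_cancel
          by (intro order_trans[OF sum_abs] sum_mono) (auto simp: abs_mult intro!: mult_left_mono)
        also have "\<dots> = ?E u * F i0 u"
          by (simp add: F_def sum_distrib_left mult_ac)
        also have "\<dots> \<le> ?E u * \<bar>N\<bar>"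
          using N[of u i0] u t0 t b by (intro mult_left_mono) auto
        finally have "\<bar>rhs u (history x u) $ i0\<bar> \<le> \<bar>N\<bar> * ?E u"
          by (simp add: mult.commute)
        moreover have "s * rhs u (history x u) $ i0 \<le> \<bar>rhs u (history x u) $ i0\<bar>"
          using s by (auto simp: s_def sgn_if)
        ultimately show ?thesis
          by linarith
      qed
      let ?\<Phi> = "\<lambda>u. s * x u $ i0 - ?E u"
      have "?\<Phi> t0 \<le> ?\<Phi> \<sigma>"
      proof (rule DERIV_nonpos_imp_decreasing_open[of \<sigma> t0 ?\<Phi>])
        show "\<sigma> \<le> t0"
          using t0 by simp
        show "continuous_on {\<sigma>..t0} ?\<Phi>"
          by (intro continuous_intros solution_component_cont[OF x])
        fix u assume u: "\<sigma> < u" "u < t0"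
        have "(?\<Phi> has_real_derivative s * rhs u (history x u) $ i0 - \<bar>N\<bar> * ?E u) (at u)"
          by (rule derivative_eq_intros solution_deriv[OF x u(1)] refl)+ simp
        then show "\<exists>y. (?\<Phi> has_real_derivative y) (at u) \<and> y \<le> 0"
          using slope[OF u] by (intro exI conjI) auto
      qed
      then have "2 * b \<le> s * x \<sigma> $ i0"
        using at_t0 by simp
      also have "\<dots> \<le> \<bar>x \<sigma> $ i0\<bar>"
        using s by (auto simp: s_def sgn_if)
      finally show False
        using at_\<sigma>[of i0] b by simp
    qed
    also have "?E t \<le> ?E S"
      using t b by (auto intro!: mult_left_mono)
    finally show "\<bar>x t $ i\<bar> < 2 * exp (\<bar>N\<bar> * (S - \<sigma>)) * b"
      by (simp add: mult_ac)
  qed simp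
qed

subsection \<open>Stability and attractivity in the phase space\<close>

lemma fde_solution_continuous:
  assumes \<phi>: "\<phi> \<in> phase_space g" and x: "fde_solution rhs \<sigma> \<phi> x"
  shows "continuous_on UNIV x"
proof -
  have past: "x w = \<phi> (w - \<sigma>)" if "w \<in> {..\<sigma>}" for w
    using x that by (auto simp: fde_solution_def history_def dest: spec[of _ "w - \<sigma>"])
  have "continuous_on {..0} \<phi>"
    using \<phi> by (simp add: phase_space_def)
  then have "continuous_on {..\<sigma>} (\<lambda>w. \<phi> (w - \<sigma>))"
    by (rule continuous_on_compose2) (auto intro!: continuous_intros)
  then have "continuous_on {..\<sigma>} x"
    using past by (subst continuous_on_cong[OF refl past]) auto
  moreover have "continuous_on {\<sigma>..} x"
    unfolding continuous_on_eq_continuous_within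
    using x by (auto simp: fde_solution_def intro: has_vector_derivative_continuous)
  ultimately have "continuous_on ({..\<sigma>} \<union> {\<sigma>..}) x"
    by (intro continuous_on_closed_Un) auto
  moreover have "{..\<sigma>} \<union> {\<sigma>..} = UNIV"
    by auto
  ultimately show ?thesis
    by simp
qed

lemma fde_solution_from:
  assumes \<phi>: "\<phi> \<in> phase_space g" and x: "fde_solution rhs \<sigma> \<phi> x"
  shows "solution_from (max \<sigma> T) x"
  unfolding solution_from_def
proof (intro conjI allI impI)
  fix t assume "max \<sigma> T \<le> t"
  then have "(x has_vector_derivative rhs t (history x t)) (at t within {\<sigma>..})"
    using x by (auto simp: fde_solution_def)
  then show "(x has_vector_derivative rhs t (history x t)) (at t within {max \<sigma> T..})"
    by (rule has_vector_derivative_within_subset) auto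
qed (auto intro: fde_solution_continuous[OF \<phi> x])

lemma fde_solution_past:
  assumes \<phi>: "\<phi> \<in> phase_space g" and x: "fde_solution rhs \<sigma> \<phi> x" and w: "w \<le> \<sigma>"
  shows "\<bar>x w $ j\<bar> \<le> phase_norm g \<phi> * g (w - \<sigma>)"
proof -
  have "x w = \<phi> (w - \<sigma>)"
    using x w by (auto simp: fde_solution_def history_def dest: spec[of _ "w - \<sigma>"])
  then show ?thesis
    using component_le_phase_norm[OF weight \<phi>, of "w - \<sigma>" j] w by simp
qed

lemma long_intrinsic_time: "\<exists>S\<ge>a. \<forall>i. 2 \<le> H i S - H i a"
proof -
  have "\<forall>\<^sub>F t in at_top. 2 + H i a \<le> H i t" for i
    using H_at_top[of i] by (simp add: filterlim_at_top)
  then have "\<forall>\<^sub>F t in at_top. \<forall>i. 2 + H i a \<le> H i t"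
    by (rule eventually_all_finite)
  from eventually_happens[OF eventually_conj[OF eventually_ge_at_top[of a] this]]
  obtain S where "a \<le> S" "\<And>i. 2 + H i a \<le> H i S"
    by auto
  then show ?thesis
    by (intro exI[of _ S]) (simp add: algebra_simps)
qed

definition "v_min = Min (range (($) v))"

lemma v_min: "0 < v_min" "v_min \<le> v $ i"
  using v_pos by (auto simp: v_min_def)

text \<open>
  The estimate of \<open>solution_growth\<close> up to \<open>S\<close> provides a common bound \<open>B\<close>, proportional to the size \<open>b\<close>
  of the initial history, which then persists. Times before \<open>\<sigma>\<close> are covered by monotonicity of \<open>g\<close>.
\<close>

lemma stable: "stable_from g rhs T"
  unfolding stable_from_def
proof (intro allI impI)
  fix \<epsilon> \<sigma> :: real assume \<epsilon>: "0 < \<epsilon>" and \<sigma>: "T \<le> \<sigma>"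
  obtain S where S: "\<sigma> + r \<le> S" "\<And>i. 2 \<le> H i S - H i (\<sigma> + r)"
    using long_intrinsic_time by blast
  have \<sigma>S: "\<sigma> \<le> S"
    using S(1) r_pos by simp
  obtain K where K: "0 < K" and growth: "\<And>x b t i. solution_from \<sigma> x \<Longrightarrow> 0 < b \<Longrightarrow>
      (\<And>w j. w \<le> \<sigma> \<Longrightarrow> \<bar>x w $ j\<bar> \<le> b * g (w - \<sigma>)) \<Longrightarrow> t \<in> {\<sigma>..S} \<Longrightarrow> \<bar>x t $ i\<bar> < K * b"
    by (rule solution_growth[OF \<sigma> \<sigma>S]) blast
  define v_max where "v_max = Max (range (($) v))"
  have v_max: "v $ i \<le> v_max" for i
    by (simp add: v_max_def)
  have v_max_pos: "0 < v_max"
    using v_pos v_max by (rule less_le_trans)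
  define C where "C = 1 + v_max * (K + 1) / v_min"
  have C: "1 \<le> C"
    using v_max_pos K v_min(1) by (simp add: C_def)
  define b where "b = \<epsilon> / (2 * C)"
  have b: "0 < b" "C * b = \<epsilon> / 2"
    using \<epsilon> C by (auto simp: b_def)
  define B where "B = (K + 1) * b / v_min"
  have B: "0 < B"
    using K b v_min(1) by (simp add: B_def)
  have vB: "(K + 1) * b \<le> v $ j * B" for j
  proof -
    have "v_min * B \<le> v $ j * B"
      using v_min(2) B by (intro mult_right_mono) auto
    then show ?thesis
      using v_min(1) by (simp add: B_def)
  qed
  have vB_upper: "v $ j * B \<le> C * b" for j
  proof -
    have "v $ j * B \<le> v_max * B"
      using v_max B by (intro mult_right_mono) auto
    also have "\<dots> \<le> C * b"
      using b(1) by (simp add: B_def C_def algebra_simps)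
    finally show ?thesis .
  qed
  show "\<exists>\<delta>>0. \<forall>\<phi>\<in>phase_space g. \<forall>x. phase_norm g \<phi> < \<delta> \<and> fde_solution rhs \<sigma> \<phi> x \<longrightarrow>
      (\<forall>t\<ge>\<sigma>. phase_norm g (history x t) < \<epsilon>)"
  proof (intro exI[of _ b] conjI ballI allI impI b(1))
    fix \<phi> x t assume \<phi>: "\<phi> \<in> phase_space g"
      and "phase_norm g \<phi> < b \<and> fde_solution rhs \<sigma> \<phi> x" and t: "\<sigma> \<le> t"
    then have small: "phase_norm g \<phi> < b" and fde: "fde_solution rhs \<sigma> \<phi> x"
      by auto
    have x: "solution_from \<sigma> x"
      using fde_solution_from[OF \<phi> fde] \<sigma> by (simp add: max_def)
    have past: "\<bar>x w $ j\<bar> \<le> b * g (w - \<sigma>)" if w: "w \<le> \<sigma>" for w j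
    proof -
      have "phase_norm g \<phi> * g (w - \<sigma>) \<le> b * g (w - \<sigma>)"
        using small phase_weight_ge_1[OF weight, of "w - \<sigma>"] w by (intro mult_right_mono) auto
      then show ?thesis
        using fde_solution_past[OF \<phi> fde w, of j] by simp
    qed
    have future: "\<bar>x u $ j\<bar> \<le> v $ j * B" if "\<sigma> \<le> u" for u j
    proof (rule solution_stays_bounded[OF x B S _ _ that])
      fix w i
      have "K * b < v $ i * B" "b \<le> v $ i * B"
        using vB[of i] b(1) mult_pos_pos[OF K b(1)] unfolding distrib_right by linarith+
      then show "\<bar>x w $ i\<bar> < v $ i * B" if "w \<in> {\<sigma>..S}"
        using growth[OF x b(1) past that, of i] by simp
      show "\<bar>x w $ i\<bar> \<le> v $ i * B * g (w - \<sigma>)" if w: "w \<le> \<sigma>"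
      proof -
        have "b * g (w - \<sigma>) \<le> v $ i * B * g (w - \<sigma>)"
          using \<open>b \<le> v $ i * B\<close> phase_weight_ge_1[OF weight, of "w - \<sigma>"] w
          by (intro mult_right_mono) auto
        then show ?thesis
          using past[OF w, of i] by simp
      qed
    qed
    have "infnorm (history x t s) / g s \<le> C * b" if s: "s \<in> {..0}" for s
    proof -
      have gs: "1 \<le> g s"
        using s by (intro phase_weight_ge_1[OF weight]) simp
      have "\<bar>history x t s $ j\<bar> \<le> C * b * g s" for j
      proof (cases "\<sigma> \<le> t + s")
        case True
        then have "\<bar>history x t s $ j\<bar> \<le> C * b * 1"
          using future[of "t + s" j] vB_upper[of j] by (simp add: history_def)
        also have "\<dots> \<le> C * b * g s"
          using gs C b(1) by (intro mult_left_mono) auto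
        finally show ?thesis .
      next
        case False
        then have "\<bar>history x t s $ j\<bar> \<le> b * g (t + s - \<sigma>)"
          using past[of "t + s" j] by (simp add: history_def)
        also have "\<dots> \<le> (C * b) * g s"
        proof (rule mult_mono)
          show "b \<le> C * b"
            using C b(1) by simp
          show "g (t + s - \<sigma>) \<le> g s"
            using False t by (intro phase_weight_antimono[OF weight]) auto
          show "0 \<le> g (t + s - \<sigma>)"
            using phase_weight_ge_1[OF weight, of "t + s - \<sigma>"] False by simp
        qed (use C b(1) in simp)
        finally show ?thesis .
      qed
      then have "infnorm (history x t s) \<le> C * b * g s"
        by (rule infnorm_le_components)
      then show ?thesis
        using gs by (simp add: pos_divide_le_eq)
    qed
    then have "phase_norm g (history x t) \<le> C * b"
      unfolding phase_norm_def by (intro cSUP_least) auto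
    then show "phase_norm g (history x t) < \<epsilon>"
      using b(2) \<epsilon> by simp
  qed
qed

text \<open>
  For \<open>\<sigma> < T\<close> the solution is regarded as starting at \<open>T\<close>; its history there is still bounded by a
  multiple of \<open>g\<close>.
\<close>

lemma attractive:
  assumes \<phi>: "\<phi> \<in> phase_space g" and fde: "fde_solution rhs \<sigma> \<phi> x"
  shows "(x \<longlongrightarrow> 0) at_top"
proof -
  define \<sigma>' where "\<sigma>' = max \<sigma> T"
  have \<sigma>': "\<sigma> \<le> \<sigma>'"
    by (simp add: \<sigma>'_def)
  have x: "solution_from \<sigma>' x"
    unfolding \<sigma>'_def by (rule fde_solution_from[OF \<phi> fde])
  obtain S where S: "\<sigma>' + r \<le> S" "\<And>i. 2 \<le> H i S - H i (\<sigma>' + r)"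
    using long_intrinsic_time by blast
  have "compact (x ` {\<sigma>..S})"
    using fde_solution_continuous[OF \<phi> fde]
    by (intro compact_continuous_image) (auto intro: continuous_on_subset)
  then have "bounded (x ` {\<sigma>..S})"
    by (rule compact_imp_bounded)
  then obtain M where "\<forall>y\<in>x ` {\<sigma>..S}. norm y \<le> M"
    unfolding bounded_iff ..
  then have M: "norm (x w) \<le> M" if "w \<in> {\<sigma>..S}" for w
    using that by blast
  define Q where "Q = max (max M (phase_norm g \<phi>)) 0"
  have between: "\<bar>x w $ j\<bar> \<le> Q" if "w \<in> {\<sigma>..S}" for w j
    using M[OF that] component_le_norm_cart[of "x w" j] by (auto simp: Q_def intro: max.coboundedI1)
  have past: "\<bar>x w $ j\<bar> \<le> Q * g (w - \<sigma>')" if w: "w \<le> \<sigma>'" for w j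
  proof (cases "w \<le> \<sigma>")
    case True
    have "phase_norm g \<phi> * g (w - \<sigma>) \<le> Q * g (w - \<sigma>')"
    proof (rule mult_mono)
      show "g (w - \<sigma>) \<le> g (w - \<sigma>')"
        using True \<sigma>' by (intro phase_weight_antimono[OF weight]) auto
      show "0 \<le> g (w - \<sigma>)"
        using phase_weight_ge_1[OF weight, of "w - \<sigma>"] True by simp
    qed (auto simp: Q_def)
    then show ?thesis
      using fde_solution_past[OF \<phi> fde True, of j] by simp
  next
    case False
    then have "\<bar>x w $ j\<bar> \<le> Q * 1"
      using between[of w j] w S(1) r_pos by simp
    also have "\<dots> \<le> Q * g (w - \<sigma>')"
      using phase_weight_ge_1[OF weight, of "w - \<sigma>'"] w by (intro mult_left_mono) (auto simp: Q_def)
    finally show ?thesis .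
  qed
  define B where "B = (Q + 1) / v_min"
  have Q: "0 \<le> Q"
    by (simp add: Q_def)
  have B: "0 < B"
    using Q v_min(1) by (simp add: B_def)
  have vB: "Q < v $ j * B" for j
  proof -
    have "v_min * B \<le> v $ j * B"
      using v_min(2) B by (intro mult_right_mono) auto
    then show ?thesis
      using v_min(1) by (simp add: B_def)
  qed
  have bounded: "\<bar>x t $ i\<bar> \<le> v $ i * B" if "\<sigma>' \<le> t" for t i
  proof (rule solution_stays_bounded[OF x B S _ _ that])
    fix w j
    show "\<bar>x w $ j\<bar> < v $ j * B" if "w \<in> {\<sigma>'..S}"
      using between[of w j] vB[of j] that \<sigma>' by auto
    show "\<bar>x w $ j\<bar> \<le> v $ j * B * g (w - \<sigma>')" if w: "w \<le> \<sigma>'"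
    proof -
      have "Q * g (w - \<sigma>') \<le> v $ j * B * g (w - \<sigma>')"
        using vB[of j] phase_weight_ge_1[OF weight, of "w - \<sigma>'"] w by (intro mult_right_mono) auto
      then show ?thesis
        using past[OF w, of j] by simp
    qed
  qed
  have "\<forall>\<^sub>F t in at_top. \<forall>i. \<bar>x t $ i\<bar> \<le> v $ i * B"
    using eventually_ge_at_top[of \<sigma>'] by eventually_elim (intro allI bounded)
  then show ?thesis
    by (rule eventually_bounded_tendsto_0[OF x B])
qed

lemma asymptotic_stability: "asymptotically_stable g rhs"
  unfolding asymptotically_stable_def using stable T_pos attractive by (auto intro: less_imp_le)

end

theorem theorem4p2:
  fixes g :: "real \<Rightarrow> real"
    and p :: nat
    and d :: "'n::finite \<Rightarrow> 'n \<Rightarrow> nat \<Rightarrow> real \<Rightarrow> real"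
    and \<tau> :: "'n \<Rightarrow> 'n \<Rightarrow> nat \<Rightarrow> real \<Rightarrow> real"
    and \<xi> :: "'n \<Rightarrow> 'n \<Rightarrow> nat \<Rightarrow> real \<Rightarrow> real \<Rightarrow> real"
    and r \<alpha> T :: real
    and v :: "real ^ 'n"
    and e :: "real \<Rightarrow> real"
  assumes weight: "phase_weight g"
    and rhs_cont: "continuous_on_phase g (system_rhs p d \<tau> \<xi>)"
    and h1_d: "\<And>i j k. k \<in> {1..p} \<Longrightarrow> continuous_on {0..} (d i j k)"
    and h1_tau: "\<And>i j k. k \<in> {1..p} \<Longrightarrow> continuous_on {0..} (\<tau> i j k)"
    and h1_tau_nonneg: "\<And>i j k t. k \<in> {1..p} \<Longrightarrow> 0 \<le> t \<Longrightarrow> 0 \<le> \<tau> i j k t"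
    and h1_xi_cont: "\<And>i j k s. k \<in> {1..p} \<Longrightarrow> s \<le> 0 \<Longrightarrow>
          continuous_on {t. 0 \<le> t \<and> - \<tau> i j k t \<le> s} (\<lambda>t. \<xi> i j k t s)"
    and h1_xi_bv: "\<And>i j k t. k \<in> {1..p} \<Longrightarrow> 0 \<le> t \<Longrightarrow>
          bounded_variation_on (- \<tau> i j k t) 0 (\<xi> i j k t)"
    and h1_xi_var: "\<And>i j k t. k \<in> {1..p} \<Longrightarrow> 0 \<le> t \<Longrightarrow>
          total_variation (- \<tau> i j k t) 0 (\<xi> i j k t) = 1"
    and h2: "\<And>i k t. k \<in> {1..p} \<Longrightarrow> 0 \<le> t \<Longrightarrow> mono_on {- \<tau> i i k t..0} (\<xi> i i k t)"
    and h3_nonneg: "\<And>i k t. k \<in> {1..p} \<Longrightarrow> 0 \<le> t \<Longrightarrow> 0 \<le> d i i k t"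
    and h3_pos: "\<And>i t. 0 \<le> t \<Longrightarrow> 0 < d_diag p d i t"
    and h4_r: "0 < r"
    and h4: "\<And>i k t. k \<in> {1..p} \<Longrightarrow> 0 \<le> t \<Longrightarrow> \<tau> i i k t \<in> {0..r}"
    and alpha: "1 < \<alpha>"
    and T_nonneg: "0 \<le> T"
    and T_r: "r \<le> T"
    and v_pos: "\<And>i. 0 < v $ i"
    and e_nonneg: "\<And>t. 0 \<le> e t"
    and e_meas: "e \<in> borel_measurable lebesgue"
    and e_locint: "\<And>a b. set_integrable lebesgue {a..b} e"
    and i: "\<And>t. T \<le> t \<Longrightarrow> e t \<le> Min (range (\<lambda>i. (M_mat g p d \<tau> t *v v) $ i))"
    and ii: "\<And>t i. T \<le> t \<Longrightarrow>
          (\<alpha> *\<^sub>R ((C_mat g p d \<tau> t + A_mat g p d \<tau> t) *v v)) $ i \<le> (D_mat p d t *v v) $ i"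
    and iii: "(\<integral>\<^sup>+ t\<in>{0..}. ennreal (e t) \<partial>lebesgue) = \<infinity>"
    and iv: "bdd_above ((\<lambda>t. LINT u:{t - max_delay p \<tau> t..t}|lebesgue. e u) ` {T..})"
  shows "asymptotically_stable g (system_rhs p d \<tau> \<xi>)"
proof -
  interpret delay_system g p d \<tau> \<xi> r \<alpha> T v e
  proof
    show "\<tau> i i k t \<le> r" if "k \<in> {1..p}" "0 \<le> t" for i k t
      using h4[OF that, of i] by simp
  qed (fact assms)+
  show ?thesis
    by (rule asymptotic_stability)
qed

end
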